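(* Let $\lessdot$ be a shuffle order on $\mathcal{A}$. For any partition $\nu$, \[ \mathfrak{J}^\lessdot_\nu(\mathbf{u})=\sum_{T\in CT^\lessdot_\nu}\mathrm{creading}(T)\quad\text{in } \mathcal{U}/I^{\mathrm{plac}}_{\lessdot}. \]
   Context: $\mathcal{A}=\{1,\dots,N\}\sqcup\{\bar1,\dots,\bar N\}$ (unbarred and barred letters); colored words are finite words in $\mathcal{A}$. A shuffle order is a total order $\lessdot$ on $\mathcal{A}$ with $1\lessdot2\lessdot\cdots\lessdot N$ and $\bar1\lessdot\cdots\lessdot\bar N$. $\mathcal{U}$ is the free associative $\mathbb{Z}$-algebra on noncommuting $u_x$ ($x\in\mathcal{A}$), monomials identified with colored words. $I^{\mathrm{plac}}_\lessdot$ is the two-sided ideal generated by: $xzy-zxy$ and $yxz-yzx$ for $x\lessdot y\lessdot z$; $yyx-yxy$ ($y$ unbarred, $x\lessdot y$); $zyy-yzy$ ($y$ unbarred, $y\lessdot z$); $yyz-yzy$ ($y$ barred, $y\lessdot z$); $xyy-yxy$ ($y$ barred, $x\lessdot y$) (all letters in $\mathcal{A}$). Write $y\succeq^\lessdot_{\mathrm{col}}x$ if $x\lessdot y$ or $x,y$ are equal barred letters. $e^\lessdot_k(\mathbf{u})=\sum u_{z_1}\cdots u_{z_k}$ over $z_1\succeq^\lessdot_{\mathrm{col}}\cdots\succeq^\lessdot_{\mathrm{col}}z_k$ ($k\ge1$), $e^\lessdot_0=1$, $e^\lessdot_k=0$ for $k<0$. For a partition $\nu$ with $t=\nu_1$,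 $\mathfrak{J}^\lessdot_\nu(\mathbf{u})=\sum_{\pi\in S_t}\mathrm{sgn}(\pi)\,e^\lessdot_{\nu'_1+\pi(1)-1}(\mathbf{u})\cdots e^\lessdot_{\nu'_t+\pi(t)-t}(\mathbf{u})$, $\nu'$ the conjugate partition. A $\lessdot$-colored tableau of shape $\nu$: filling of the Young diagram of $\nu$ (English convention) by letters of $\mathcal{A}$, rows and columns weakly increasing for $\lessdot$, unbarred letters strictly increasing down columns, barred letters strictly increasing along rows; $CT^\lessdot_\nu$ is the set of these. $\mathrm{creading}(T)$ is the concatenation of the columns of $T$, each read bottom to top, starting from the leftmost column. *)

theory Defs
  imports
    "HOL-Library.Poly_Mapping"
    "HOL-Library.FuncSet"
    "HOL-Combinatorics.Permutations"
    "HOL-Algebra.QuotRing"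
begin

datatype letter = Unbarred nat | Barred nat

definition barred :: "letter \<Rightarrow> bool" where
  "barred x \<longleftrightarrow> (\<exists>i. x = Barred i)"

definition alphabet :: "nat \<Rightarrow> letter set" where
  "alphabet N = Unbarred ` {1..N} \<union> Barred ` {1..N}"

text \<open>Only the restriction of \<open>lt\<close> to \<open>alphabet N\<close> is ever used.\<close>

definition shuffle_order :: "nat \<Rightarrow> (letter \<Rightarrow> letter \<Rightarrow> bool) \<Rightarrow> bool" where
  "shuffle_order N lt \<longleftrightarrow>
     irreflp_on (alphabet N) lt \<and> transp_on (alphabet N) lt \<and> totalp_on (alphabet N) lt \<and>
     (\<forall>i\<in>{1..N}. \<forall>j\<in>{1..N}. i < j \<longrightarrow>
        lt (Unbarred i) (Unbarred j) \<and> lt (Barred i) (Barred j))"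

text \<open>
  The free monoid on letters, written additively because \<^type>\<open>poly_mapping\<close> takes the
  convolution product over an additive (here noncommutative) monoid of exponents.
  Thus \<open>word \<Rightarrow>\<^sub>0 int\<close> is the free associative \<open>\<int>\<close>-algebra on all letters.
\<close>

datatype word = Word (letters: "letter list")

instantiation word :: monoid_add
begin
definition zero_word :: word where "0 = Word []"
definition plus_word :: "word \<Rightarrow> word \<Rightarrow> word" where "v + w = Word (letters v @ letters w)"
instance by standard (auto simp: zero_word_def plus_word_def)
end

type_synonym word_poly = "word \<Rightarrow>\<^sub>0 int"

definition word_mon :: "letter list \<Rightarrow> word_poly" where
  "word_mon w = Poly_Mapping.single (Word w) 1"

definition free_alg :: "nat \<Rightarrow> word_poly ring" where
  "free_alg N =
     \<lparr>carrier = {f. \<forall>w\<in>Poly_Mapping.keys f. set (letters w) \<subseteq> alphabet N},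
      mult = (*), one = 1, zero = 0, add = (+)\<rparr>"

definition plac_gens :: "nat \<Rightarrow> (letter \<Rightarrow> letter \<Rightarrow> bool) \<Rightarrow> word_poly set" where
  "plac_gens N lt =
     {word_mon [x,z,y] - word_mon [z,x,y] | x y z.
        {x,y,z} \<subseteq> alphabet N \<and> lt x y \<and> lt y z} \<union>
     {word_mon [y,x,z] - word_mon [y,z,x] | x y z.
        {x,y,z} \<subseteq> alphabet N \<and> lt x y \<and> lt y z} \<union>
     {word_mon [y,y,x] - word_mon [y,x,y] | x y.
        {x,y} \<subseteq> alphabet N \<and> \<not> barred y \<and> lt x y} \<union>
     {word_mon [z,y,y] - word_mon [y,z,y] | y z.
        {y,z} \<subseteq> alphabet N \<and> \<not> barred y \<and> lt y z} \<union>
     {word_mon [y,y,z] - word_mon [y,z,y] | y z.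
        {y,z} \<subseteq> alphabet N \<and> barred y \<and> lt y z} \<union>
     {word_mon [x,y,y] - word_mon [y,x,y] | x y.
        {x,y} \<subseteq> alphabet N \<and> barred y \<and> lt x y}"

definition plac_ideal :: "nat \<Rightarrow> (letter \<Rightarrow> letter \<Rightarrow> bool) \<Rightarrow> word_poly set" where
  "plac_ideal N lt = Idl\<^bsub>free_alg N\<^esub> (plac_gens N lt)"

definition col_ge :: "(letter \<Rightarrow> letter \<Rightarrow> bool) \<Rightarrow> letter \<Rightarrow> letter \<Rightarrow> bool" where
  "col_ge lt y x \<longleftrightarrow> lt x y \<or> (x = y \<and> barred x)"

definition elem_sym :: "nat \<Rightarrow> (letter \<Rightarrow> letter \<Rightarrow> bool) \<Rightarrow> int \<Rightarrow> word_poly" where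
  "elem_sym N lt k =
     (if k < 0 then 0
      else if k = 0 then 1
      else \<Sum>w | set w \<subseteq> alphabet N \<and> int (length w) = k \<and> successively (col_ge lt) w. word_mon w)"

definition is_partition :: "nat list \<Rightarrow> bool" where
  "is_partition \<nu> \<longleftrightarrow> sorted_wrt (\<ge>) \<nu> \<and> 0 \<notin> set \<nu>"

text \<open>Rows, columns and parts are numbered from 1; \<open>part \<nu> i = 0\<close> beyond the last part.\<close>

definition part :: "nat list \<Rightarrow> nat \<Rightarrow> nat" where
  "part \<nu> i = (if 1 \<le> i \<and> i \<le> length \<nu> then \<nu> ! (i - 1) else 0)"

definition diagram :: "nat list \<Rightarrow> (nat \<times> nat) set" where
  "diagram \<nu> = {(i, j). 1 \<le> i \<and> 1 \<le> j \<and> j \<le> part \<nu> i}"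

definition conj_part :: "nat list \<Rightarrow> nat \<Rightarrow> nat" where
  "conj_part \<nu> j = card {i. (i, j) \<in> diagram \<nu>}"

definition nc_schur :: "nat \<Rightarrow> (letter \<Rightarrow> letter \<Rightarrow> bool) \<Rightarrow> nat list \<Rightarrow> word_poly" where
  "nc_schur N lt \<nu> =
     (let t = part \<nu> 1 in
      \<Sum>\<pi> | \<pi> permutes {1..t}.
        of_int (sign \<pi>) *
        prod_list (map (\<lambda>j. elem_sym N lt (int (conj_part \<nu> j) + int (\<pi> j) - int j)) [1..<Suc t]))"

definition colored_tableaux ::
  "nat \<Rightarrow> (letter \<Rightarrow> letter \<Rightarrow> bool) \<Rightarrow> nat list \<Rightarrow> (nat \<times> nat \<Rightarrow> letter) set" where
  "colored_tableaux N lt \<nu> =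
     {T \<in> diagram \<nu> \<rightarrow>\<^sub>E alphabet N.
        (\<forall>i j j'. (i, j) \<in> diagram \<nu> \<and> (i, j') \<in> diagram \<nu> \<and> j < j' \<longrightarrow>
           lt (T (i, j)) (T (i, j')) \<or> (T (i, j) = T (i, j') \<and> \<not> barred (T (i, j)))) \<and>
        (\<forall>i i' j. (i, j) \<in> diagram \<nu> \<and> (i', j) \<in> diagram \<nu> \<and> i < i' \<longrightarrow>
           lt (T (i, j)) (T (i', j)) \<or> (T (i, j) = T (i', j) \<and> barred (T (i, j))))}"

definition creading :: "nat list \<Rightarrow> (nat \<times> nat \<Rightarrow> letter) \<Rightarrow> letter list" where
  "creading \<nu> T =
     concat (map (\<lambda>j. map (\<lambda>i. T (i, j)) (rev [1..<Suc (conj_part \<nu> j)])) [1..<Suc (part \<nu> 1)])"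

lemma word_mon_append: "word_mon (v @ w) = word_mon v * word_mon w"
  by (simp add: word_mon_def mult_single plus_word_def)

lemma word_mon_Nil: "word_mon [] = 1"
  by (simp add: word_mon_def zero_word_def[symmetric])

lemma ring_free_alg: "ring (free_alg N)"
proof -
  have plus: "f + g \<in> carrier (free_alg N)"
    if "f \<in> carrier (free_alg N)" "g \<in> carrier (free_alg N)" for f g
    using that keys_add[of f g] by (auto simp: free_alg_def)
  have times: "f * g \<in> carrier (free_alg N)"
    if "f \<in> carrier (free_alg N)" "g \<in> carrier (free_alg N)" for f g
    using that keys_mult[of f g] by (fastforce simp: free_alg_def plus_word_def)
  have minus: "- f \<in> carrier (free_alg N)" if "f \<in> carrier (free_alg N)" for f
    using that by (simp add: free_alg_def)
  have one: "1 \<in> carrier (free_alg N)"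
    using word_mon_Nil by (auto simp: free_alg_def word_mon_def zero_word_def split: if_splits)
  have zero: "0 \<in> carrier (free_alg N)"
    by (simp add: free_alg_def)
  have ops: "mult (free_alg N) = (*)" "monoid.one (free_alg N) = 1"
    "ring.zero (free_alg N) = 0" "add (free_alg N) = (+)"
    by (simp_all add: free_alg_def)
  show ?thesis
  proof (rule ringI)
    show "abelian_group (free_alg N)"
    proof (rule abelian_groupI, unfold ops)
      fix f assume "f \<in> carrier (free_alg N)"
      from minus[OF this] show "\<exists>g\<in>carrier (free_alg N). g + f = 0"
        by (intro bexI[of _ "- f"]) simp_all
    qed (rule plus zero add.assoc add.commute add_0; assumption)+
    show "monoid (free_alg N)"
      by (rule monoidI, unfold ops) (rule times one mult.assoc mult_1_left mult_1_right; assumption)+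
  qed (unfold ops, (rule distrib_right distrib_left)+)
qed

lemma plac_gens_subset: "plac_gens N lt \<subseteq> carrier (free_alg N)"
proof -
  have "word_mon v - word_mon w \<in> carrier (free_alg N)"
    if "set v \<subseteq> alphabet N" "set w \<subseteq> alphabet N" for v w
    using that subsetD[OF keys_diff[of "word_mon v" "word_mon w"]]
    by (fastforce simp: free_alg_def word_mon_def)
  then show ?thesis
    unfolding plac_gens_def by auto
qed

text \<open>The index sets of the two sums are finite, so neither sum collapses to 0 by convention.\<close>

lemma finite_alphabet: "finite (alphabet N)"
  by (simp add: alphabet_def)

lemma finite_elem_sym_words:
  "finite {w. set w \<subseteq> alphabet N \<and> int (length w) = k \<and> successively (col_ge lt) w}"
  by (rule finite_subset[OF _ finite_lists_length_eq[OF finite_alphabet, of N "nat k"]]) auto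

lemma finite_diagram: "finite (diagram \<nu>)"
proof (rule finite_subset)
  show "diagram \<nu> \<subseteq> (SIGMA i:{1..length \<nu>}. {1..part \<nu> i})"
    by (auto simp: diagram_def part_def split: if_splits)
qed auto

lemma finite_colored_tableaux: "finite (colored_tableaux N lt \<nu>)"
  by (rule finite_subset[OF _ finite_PiE[OF finite_diagram[of \<nu>], of "\<lambda>_. alphabet N"]])
     (auto simp: colored_tableaux_def finite_alphabet)

end

(*
  Idea. Write S(l) for the sum of the column readings of all tableaux with column lengths
  l = (l_1, ..., l_t), zeros allowed. Column insertion of an increasing word into a column is a
  plactic congruence on reading words, and pushing it through all columns of a tableau gives a
  bijection that yields the left Pieri rule: e_k S(l) is the sum of the S(m) of the appropriate
  size with m_1 >= l_1 >= m_2 >= ... >= l_t >= m_(t+1). For t = 1 the right-hand side is symmetric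
  in the two column lengths, hence the e_k commute. Therefore the determinant may be transposed
  and expanded along its first column; the minors are again Jacobi-Trudi determinants, for
  (l_1 + 1, ..., l_(b-1) + 1, l_(b+1), ..., l_t), so they are known by induction. After applying
  the Pieri rule, the alternating sum telescopes according to whether m_b <= l_b.
*)
theory Submission
  imports Defs "Jordan_Normal_Form.Determinant"
begin

section \<open>Column insertion\<close>

text \<open>Barred and unbarred letters are treated together. \<open>col x y\<close> means that
  \<open>x\<close> may stand below \<open>y\<close> in a column, and its negation
  \<open>row x y\<close> that \<open>x\<close> may stand left of \<open>y\<close> in a row. Column
  insertion uses only that both relations are transitive, and the six families of generators become
  two relations.

  The transposition is forced because the Pieri rule multiplies on the left. Splitting the leftmost
  factor off \<open>nc_schur\<close> deletes the first row of the matrix together with some column,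
  which in general leaves a determinant of skew type. Deleting the first column and a row leaves a
  straight shape again, so an induction on the number of columns can run.

  Bijectivity rests on a property of increasing words: the letters that bump form a prefix of the
  word, and the others are appended at the bottom of the column. The old column length therefore
  determines where the insertion is to be undone.\<close>

fun interlaces :: "nat list \<Rightarrow> nat list \<Rightarrow> bool" where
  "interlaces [m] [] = True"
| "interlaces (m # m' # ms) (l # ls) = (l \<le> m \<and> m' \<le> l \<and> interlaces (m' # ms) ls)"
| "interlaces _ _ = False"

text \<open>For partitions given by column lengths this is the addition of a vertical strip, at most
  one cell per row; the extra last column may be empty. The positionwise form is the one used for
  the cancellation in \<open>alternating_pieri\<close>.\<close>

lemma interlaces_iff_nth:
  "interlaces ms ls \<longleftrightarrow>
     length ms = Suc (length ls) \<and> (\<forall>j<length ls. ms ! Suc j \<le> ls ! j \<and> ls ! j \<le> ms ! j)"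
proof (induction ms ls rule: interlaces.induct)
  case (2 m m' ms l ls)
  have "(\<forall>j<Suc (length ls). (m # m' # ms) ! Suc j \<le> (l # ls) ! j \<and> (l # ls) ! j \<le> (m # m' # ms) ! j) \<longleftrightarrow>
      m' \<le> l \<and> l \<le> m \<and> (\<forall>j<length ls. (m' # ms) ! Suc j \<le> ls ! j \<and> ls ! j \<le> (m' # ms) ! j)"
    by (subst All_less_Suc2) auto
  with 2 show ?case by auto
qed auto

lemma interlaces_length: "interlaces ms ls \<Longrightarrow> length ms = Suc (length ls)"
  by (induction ms ls rule: interlaces.induct) auto

lemma interlaces_sum_list: "interlaces ms ls \<Longrightarrow> sum_list ls \<le> sum_list ms"
  by (induction ms ls rule: interlaces.induct) auto

lemma finite_interlaces: "finite {ms. interlaces ms ls \<and> int (sum_list ms) = k}"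
proof (rule finite_subset)
  show "{ms. interlaces ms ls \<and> int (sum_list ms) = k} \<subseteq>
      {ms. set ms \<subseteq> {..nat k} \<and> length ms = Suc (length ls)}"
    using member_le_sum_list by (fastforce simp: interlaces_length)
qed (simp add: finite_lists_length_eq)

section \<open>Insertion into one column, for an abstract pair of relations\<close>

locale bumping =
  fixes col :: "'a \<Rightarrow> 'a \<Rightarrow> bool"
  assumes col_trans: "col x y \<Longrightarrow> col y z \<Longrightarrow> col x z"
    and not_col_trans: "\<not> col x y \<Longrightarrow> \<not> col y z \<Longrightarrow> \<not> col x z"
begin

text \<open>With the exact complement of \<open>col\<close>, repetition of a letter is decided by
  \<open>col x x\<close> alone: barred letters repeat in columns, unbarred ones in rows.\<close>

abbreviation row :: "'a \<Rightarrow> 'a \<Rightarrow> bool" where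
  "row x y \<equiv> \<not> col x y"

definition column :: "'a list \<Rightarrow> bool" where
  "column = sorted_wrt (\<lambda>x y. col y x)"

lemma column_simps [simp]:
  "column []"
  "column (x # c) \<longleftrightarrow> (\<forall>y\<in>set c. col y x) \<and> column c"
  "column (c @ d) \<longleftrightarrow> column c \<and> column d \<and> (\<forall>x\<in>set c. \<forall>y\<in>set d. col y x)"
  by (auto simp: column_def sorted_wrt_append)

lemma column_nth: "column c \<Longrightarrow> i < j \<Longrightarrow> j < length c \<Longrightarrow> col (c ! j) (c ! i)"
  unfolding column_def using sorted_wrt_nth_less[of "\<lambda>x y. col y x" c i j] by simp

text \<open>
  Columns are listed from top to bottom, so the reading word of \<open>c\<close> is \<open>rev c\<close>, and \<open>bump w c\<close>
  inserts the reading word of \<open>w\<close> starting from its last letter. The second components collect the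
  bumped letters; a single insertion bumps at most one.
\<close>

fun ins :: "'a \<Rightarrow> 'a list \<Rightarrow> 'a list \<times> 'a list" where
  "ins x [] = ([x], [])"
| "ins x (y # c) = (if row x y then (x # c, [y]) else (y # fst (ins x c), snd (ins x c)))"

fun bump :: "'a list \<Rightarrow> 'a list \<Rightarrow> 'a list \<times> 'a list" where
  "bump [] c = (c, [])"
| "bump (x # w) c = (fst (bump w (fst (ins x c))), snd (ins x c) @ snd (bump w (fst (ins x c))))"

lemma ins_skip: "\<forall>e\<in>set E. col x e \<Longrightarrow> ins x (E @ c) = (E @ fst (ins x c), snd (ins x c))"
  by (induction E) auto

lemma ins_cases:
  obtains (append) "\<forall>y\<in>set c. col x y" "ins x c = (c @ [x], [])"
  | (bump) E y D where "c = E @ y # D" "\<forall>e\<in>set E. col x e" "row x y" "ins x c = (E @ x # D, [y])"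
proof (cases "\<forall>y\<in>set c. col x y")
  case True
  with ins_skip[of c x "[]"] show thesis by (intro append) auto
next
  case False
  then obtain E y D where "c = E @ y # D" "row x y" "\<forall>e\<in>set E. col x e"
    using split_list_first_prop[of c "row x"] by auto
  with ins_skip[of E x "y # D"] show thesis by (intro bump) auto
qed

lemma bump_skip:
  "\<forall>e\<in>set E. \<forall>x\<in>set w. col x e \<Longrightarrow> bump w (E @ c) = (E @ fst (bump w c), snd (bump w c))"
  by (induction w arbitrary: c) (auto simp: ins_skip)

lemma bump_append:
  "bump (v @ w) c =
     (fst (bump w (fst (bump v c))), snd (bump v c) @ snd (bump w (fst (bump v c))))"
  by (induction v arbitrary: c) auto

text \<open>
  For an increasing word the letters of the column are matched greedily with those of the word,
  as in a system of parentheses.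
\<close>

lemma bump_Cons_Cons:
  assumes "column (x # w)"
  shows "bump (x # w) (y # c) =
    (if row x y then (x # fst (bump w c), y # snd (bump w c))
     else (y # fst (bump (x # w) c), snd (bump (x # w) c)))"
proof (cases "row x y")
  case True
  with assms bump_skip[of "[x]" w c] show ?thesis by simp
next
  case False
  with assms have "\<forall>z\<in>set w. col z y" by (auto intro: col_trans)
  with False bump_skip[of "[y]" w "fst (ins x c)"] show ?thesis by simp
qed

lemma bump_Nil: "column w \<Longrightarrow> bump w [] = (w, [])"
  by (induction w) (use bump_skip[of "[x]" _ "[]" for x] in auto)

text \<open>A match consumes a letter of the word and one of the column, a skip only one of the
  column, so the total length decreases. For increasing words this replaces the recursion defining
  \<open>bump\<close>, which works through the whole column for each letter.\<close>

lemma bump_induct [consumes 1, case_names Nil1 Nil2 match skip]: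
  assumes "column w" "\<And>c. P [] c" "\<And>w. column w \<Longrightarrow> P w []"
    "\<And>x w y c. column (x # w) \<Longrightarrow> row x y \<Longrightarrow> P w c \<Longrightarrow> P (x # w) (y # c)"
    "\<And>x w y c. column (x # w) \<Longrightarrow> col x y \<Longrightarrow> P (x # w) c \<Longrightarrow> P (x # w) (y # c)"
  shows "P w c"
  using assms(1)
proof (induction "length w + length c" arbitrary: w c rule: less_induct)
  case less
  show ?case
  proof (cases w)
    case (Cons x w')
    show ?thesis
    proof (cases c)
      case (Cons y c')
      show ?thesis
      proof (cases "row x y")
        case True
        have "P w' c'" using less Cons \<open>w = _\<close> by simp
        with True less.prems Cons \<open>w = _\<close> assms(4) show ?thesis by simp
      next
        case False
        have "P (x # w') c'" using less Cons \<open>w = _\<close> by simp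
        with False less.prems Cons \<open>w = _\<close> assms(5) show ?thesis by simp
      qed
    qed (use less assms in auto)
  qed (use assms in auto)
qed

lemma ins_mset: "mset (fst (ins x c)) + mset (snd (ins x c)) = add_mset x (mset c)"
  by (induction c) auto

lemma bump_mset: "mset (fst (bump w c)) + mset (snd (bump w c)) = mset w + mset c"
proof (induction w arbitrary: c)
  case (Cons x w)
  have "mset (fst (bump (x # w) c)) + mset (snd (bump (x # w) c)) =
      mset (snd (ins x c)) + (mset w + mset (fst (ins x c)))"
    unfolding Cons.IH[symmetric] by simp
  also have "\<dots> = mset w + (mset (fst (ins x c)) + mset (snd (ins x c)))"
    by simp
  finally show ?case by (simp add: ins_mset)
qed auto

lemma bump_length: "length (fst (bump w c)) + length (snd (bump w c)) = length w + length c"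
  using arg_cong[OF bump_mset[of w c], of size] by simp

text \<open>Later letters of an increasing word pass below those already inserted, so no inserted
  letter is bumped again.\<close>

lemma snd_bump_subset: "column w \<Longrightarrow> set (snd (bump w c)) \<subseteq> set c"
  by (induction w c rule: bump_induct) (auto simp: bump_Cons_Cons bump_Nil simp del: bump.simps(2))

lemma subset_fst_bump: "column w \<Longrightarrow> set w \<subseteq> set (fst (bump w c))"
  by (induction w c rule: bump_induct) (auto simp: bump_Cons_Cons bump_Nil simp del: bump.simps(2))

lemma column_snd_bump: "column w \<Longrightarrow> column c \<Longrightarrow> column (snd (bump w c))"
proof (induction w c rule: bump_induct)
  case (match x w y c)
  moreover have "set (snd (bump w c)) \<subseteq> set c"
    using match.hyps by (intro snd_bump_subset) simp
  ultimately show ?case by (auto simp: bump_Cons_Cons simp del: bump.simps(2))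
qed (auto simp: bump_Cons_Cons bump_Nil simp del: bump.simps(2))

lemma length_snd_bump:
  "column w \<Longrightarrow> length (snd (bump w c)) \<le> length c"
  "column w \<Longrightarrow> length (snd (bump w c)) \<le> length w"
  by (induction w c rule: bump_induct) (auto simp: bump_Cons_Cons bump_Nil simp del: bump.simps(2))

lemma length_ins: "length c \<le> length (fst (ins x c))"
  by (induction c) auto

lemma length_bump: "length c \<le> length (fst (bump w c))"
  by (induction w arbitrary: c) (auto intro: order_trans[OF length_ins])

text \<open>By contradiction: \<open>col e y\<close> would give \<open>col x y\<close>, and
  \<open>row y e\<close> would give \<open>row x e\<close>. Typically \<open>x\<close> is the
  inserted letter, \<open>y\<close> the bumped one and \<open>e\<close> a letter above them.\<close>

lemma mixed: "col x e \<Longrightarrow> row x y \<Longrightarrow> row e y" "col x e \<Longrightarrow> row x y \<Longrightarrow> col y e"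
  using col_trans not_col_trans by blast+

lemma column_fst_ins:
  assumes "column c"
  shows "column (fst (ins x c))"
proof (cases rule: ins_cases[where x = x and c = c])
  case (bump E y D)
  have "col d x" if "d \<in> set D" for d
    using assms bump that not_col_trans[of d x y] by auto
  with assms bump show ?thesis by auto
qed (use assms in auto)

lemma column_fst_bump: "column c \<Longrightarrow> column (fst (bump w c))"
  by (induction w arbitrary: c) (auto intro: column_fst_ins)

text \<open>The greedy matching skips letters of the column but none of the word, so the
  \<open>i\<close>-th bumped letter is bumped by \<open>w ! i\<close>.\<close>

lemma row_snd_bump:
  "column w \<Longrightarrow> i < length (snd (bump w c)) \<Longrightarrow> row (w ! i) (snd (bump w c) ! i)"
  by (induction w c arbitrary: i rule: bump_induct)
    (auto simp: bump_Cons_Cons bump_Nil nth_Cons' simp del: bump.simps(2))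

text \<open>\<open>w ! i\<close> lands in row \<open>i\<close> or lower, because the earlier letters
  of \<open>w\<close> are above it. The entry of row \<open>i\<close> is thus this letter or one
  that it has passed.\<close>

lemma fst_bump_nth:
  "column w \<Longrightarrow> i < length w \<Longrightarrow> fst (bump w c) ! i = w ! i \<or> col (w ! i) (fst (bump w c) ! i)"
proof (induction w c arbitrary: i rule: bump_induct)
  case (skip x w y c)
  show ?case
  proof (cases i)
    case (Suc j)
    with skip.prems skip.IH[of j] have "fst (bump (x # w) c) ! j = (x # w) ! j \<or>
        col ((x # w) ! j) (fst (bump (x # w) c) ! j)"
      by simp
    moreover have "col ((x # w) ! i) ((x # w) ! j)"
      using column_nth[OF skip.hyps(1), of j i] Suc skip.prems by simp
    ultimately show ?thesis
      using skip.hyps Suc by (auto simp: bump_Cons_Cons simp del: bump.simps(2) intro: col_trans)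
  qed (use skip.hyps in \<open>auto simp: bump_Cons_Cons simp del: bump.simps(2)\<close>)
qed (auto simp: bump_Cons_Cons bump_Nil nth_Cons' simp del: bump.simps(2))

section \<open>Insertion into two adjacent columns\<close>

definition tab :: "'a list \<Rightarrow> 'a list \<Rightarrow> bool" where
  "tab c d \<longleftrightarrow> length d \<le> length c \<and> (\<forall>i<length d. row (c ! i) (d ! i))"

lemma tab_Nil [simp]: "tab c []"
  by (simp add: tab_def)

lemma ins_cases_nth:
  assumes "column c"
  obtains i where "i = length c" "fst (ins x c) = c @ [x]" "snd (ins x c) = []"
      "\<forall>k<i. col x (c ! k)"
  | i where "i < length c" "fst (ins x c) = c[i := x]" "snd (ins x c) = [c ! i]" "row x (c ! i)"
      "\<forall>k<i. col x (c ! k)" "\<forall>k\<in>{i<..<length c}. row x (c ! k)"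
proof (cases rule: ins_cases[where x = x and c = c])
  case append
  then show thesis by (intro that(1)) auto
next
  case (bump E y D)
  have "row x (c ! k)" if "length E < k" "k < length c" for k
    using column_nth[OF assms that] bump col_trans[of x "c ! k" y] by auto
  with bump show thesis by (intro that(2)[of "length E"]) (auto simp: nth_append)
qed

text \<open>\<open>j\<close> is the row in which \<open>x\<close> lands; \<open>j = length c\<close>
  is the case without bumping, and \<open>max\<close> covers both cases.\<close>

lemma ins_nth:
  assumes "column c"
  obtains j where "j \<le> length c" "\<forall>k<j. col x (c ! k)"
    "length (fst (ins x c)) = max (length c) (Suc j)" "\<forall>k\<in>{j..<length c}. row x (c ! k)"
    "\<forall>k < max (length c) (Suc j). fst (ins x c) ! k = (if k = j then x else c ! k)"
  using assms
proof (cases rule: ins_cases_nth[where x = x and c = c])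
    case (1 j)
    then show thesis by (intro that[of j]) (auto simp: nth_append less_Suc_eq max_def)
  next
    case (2 j)
    then have "row x (c ! k)" if "k \<in> {j..<length c}" for k
      using that by (cases "k = j") auto
    with 2 show thesis by (intro that[of j]) (auto simp: nth_list_update max_def)
qed

text \<open>The bumped letter moves weakly upwards: it leaves row \<open>i\<close> of the left
  column and lands in a row \<open>j <= i\<close> of the right one. There it has on its left either
  \<open>x\<close> or a letter that \<open>x\<close> has passed, and \<open>mixed\<close> gives the
  row condition.\<close>

lemma tab_ins:
  assumes "column c" "column c'" "tab c c'" "snd (ins x c) = [y]"
  shows "tab (fst (ins x c)) (fst (ins y c'))"
  using assms(1)
proof (cases rule: ins_cases_nth[where x = x and c = c])
  case (2 i)
  with assms(4) have y: "y = c ! i" and x: "row x y" by simp_all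
  have less: "row (c ! k) y" if "k < i" for k
    using that 2 y mixed(1) by blast
  have len: "length c' \<le> length c" and rows: "row (c ! k) (c' ! k)" if "k < length c'" for k
    using assms(3) that by (auto simp: tab_def)
  obtain j where j: "j \<le> length c'" "\<forall>k<j. col y (c' ! k)"
    "length (fst (ins y c')) = max (length c') (Suc j)" "\<forall>k\<in>{j..<length c'}. row y (c' ! k)"
    "\<forall>k < max (length c') (Suc j). fst (ins y c') ! k = (if k = j then y else c' ! k)"
    by (rule ins_nth[OF assms(2), where x = y])
  note nth = j(5)[rule_format]
  \<comment> \<open>Otherwise \<open>y\<close> would have passed \<open>c' ! i\<close>, although
    \<open>y = c ! i\<close> stood left of that letter.\<close>
  have "j \<le> i"
  proof (rule ccontr)
    assume "\<not> j \<le> i"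
    with j rows[of i] y show False by auto
  qed
  show ?thesis
    unfolding tab_def j(3)
  proof (intro conjI allI impI)
    show "max (length c') (Suc j) \<le> length (fst (ins x c))"
      using 2 \<open>j \<le> i\<close> assms(3) by (auto simp: tab_def)
    fix k assume k: "k < max (length c') (Suc j)"
    show "row (fst (ins x c) ! k) (fst (ins y c') ! k)"
    proof (cases "k = j")
      case True
      with k nth 2 \<open>j \<le> i\<close> less[of k] x show ?thesis by (cases "k = i") auto
    next
      case False
      with k j have "k < length c'" by auto
      then have "row (c ! k) (c' ! k)" by (rule rows)
      with False k nth 2 x y not_col_trans[of x y "c' ! k"] show ?thesis by (cases "k = i") auto
    qed
  qed
qed (use assms in auto)

text \<open>Again \<open>j <= i\<close>, now read off the result: if \<open>j > i\<close>, row
  \<open>Suc i\<close> would pair \<open>c ! Suc i\<close>, a letter below \<open>y\<close> in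
  \<open>c\<close>, with \<open>y\<close> or with a letter that \<open>y\<close> has passed, against
  the row condition.\<close>

lemma tab_ins_rev:
  assumes "column c" "column c'" "tab (fst (ins x c)) (fst (ins y c'))" "snd (ins x c) = [y]"
  shows "tab c c'"
  using assms(1)
proof (cases rule: ins_cases_nth[where x = x and c = c])
  case (2 i)
  with assms(4) have y: "y = c ! i" and x: "row x y" by simp_all
  have greater: "col (c ! k) y" if "i < k" "k < length c" for k
    using that column_nth[OF assms(1)] y by simp
  obtain j where j: "j \<le> length c'" "\<forall>k<j. col y (c' ! k)"
    "length (fst (ins y c')) = max (length c') (Suc j)" "\<forall>k\<in>{j..<length c'}. row y (c' ! k)"
    "\<forall>k < max (length c') (Suc j). fst (ins y c') ! k = (if k = j then y else c' ! k)"
    by (rule ins_nth[OF assms(2), where x = y])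
  note nth = j(5)[rule_format]
  have len: "max (length c') (Suc j) \<le> length c"
    and rows: "\<And>k. k < max (length c') (Suc j) \<Longrightarrow>
      row (c[i := x] ! k) (if k = j then y else c' ! k)"
    using assms(3) 2 j(3) nth by (auto simp: tab_def)
  have "j \<le> i"
  proof (rule ccontr)
    assume *: "\<not> j \<le> i"
    then have "row (c ! Suc i) (if Suc i = j then y else c' ! Suc i)"
      using rows[of "Suc i"] by auto
    moreover have "col (c ! Suc i) y" using greater[of "Suc i"] * len by simp
    ultimately show False using j(2) * by (auto split: if_splits intro: col_trans)
  qed
  show ?thesis
    unfolding tab_def
  proof (intro conjI allI impI)
    show "length c' \<le> length c" using len by simp
    fix k assume k: "k < length c'"
    consider "k = i" | "k = j" "k \<noteq> i" | "k \<noteq> i" "k \<noteq> j" by auto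
    then show "row (c ! k) (c' ! k)"
    proof cases
      case 1
      with k j(4) y \<open>j \<le> i\<close> show ?thesis by simp
    next
      case 2
      with rows[of j] k have "row (c ! k) y" by simp
      moreover have "row y (c' ! k)" using 2 k j(4) by simp
      ultimately show ?thesis by (rule not_col_trans)
    next
      case 3
      with rows[of k] k show ?thesis by simp
    qed
  qed
qed (use assms in auto)

lemma snd_ins: "snd (ins x c) = [] \<or> (\<exists>y. snd (ins x c) = [y])"
  by (cases rule: ins_cases[where x = x and c = c]) auto

lemma tab_bump:
  "column c \<Longrightarrow> column c' \<Longrightarrow> tab c c' \<Longrightarrow> tab (fst (bump w c)) (fst (bump (snd (bump w c)) c'))"
proof (induction w arbitrary: c c')
  case (Cons x w)
  have "tab (fst (ins x c)) (fst (bump (snd (ins x c)) c'))"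
  proof (cases "snd (ins x c) = []")
    case True
    with Cons.prems show ?thesis
      by (cases rule: ins_cases[where x = x and c = c]) (auto simp: tab_def nth_append)
  qed (use Cons.prems snd_ins[of x c] in \<open>auto intro: tab_ins\<close>)
  with Cons show ?case
    by (simp add: bump_append column_fst_ins column_fst_bump)
qed simp

text \<open>The final pair only compares the second column with the lengthened first one. The length
  hypothesis rules out a second column that fits solely because letters were appended to
  \<open>c\<close>.\<close>

lemma tab_bump_rev:
  assumes "column c" "column c'"
    and "tab (fst (bump w c)) (fst (bump (snd (bump w c)) c'))"
    and "length (fst (bump (snd (bump w c)) c')) \<le> length c"
  shows "tab c c'"
  using assms
proof (induction w arbitrary: c c')
  case (Cons x w)
  define e e' where "e = fst (ins x c)" and "e' = fst (bump (snd (ins x c)) c')"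
  have "tab e e'"
  proof (rule Cons.IH)
    show "column e" "column e'"
      using Cons.prems(1,2) by (simp_all add: e_def e'_def column_fst_ins column_fst_bump)
    show "tab (fst (bump w e)) (fst (bump (snd (bump w e)) e'))"
      using Cons.prems(3) by (simp add: e_def e'_def bump_append)
    show "length (fst (bump (snd (bump w e)) e')) \<le> length e"
      using Cons.prems(4) length_ins[of c x] by (simp add: e_def e'_def bump_append)
  qed
  show ?case
  proof (cases "snd (ins x c) = []")
    case True
    have "length c' \<le> length c"
      using Cons.prems(4) length_bump[of c' "snd (bump (x # w) c)"] by simp
    with True \<open>tab e e'\<close> show ?thesis unfolding e_def e'_def
      by (cases rule: ins_cases[where x = x and c = c]) (auto simp: tab_def nth_append)
  next
    case False
    then obtain y where "snd (ins x c) = [y]" using snd_ins[of x c] by auto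
    with \<open>tab e e'\<close> Cons.prems(1,2) show ?thesis
      by (intro tab_ins_rev[of c c' x y]) (simp_all add: e_def e'_def)
  qed
qed simp

section \<open>Inverting the insertion into one column\<close>

lemma bump_split:
  assumes "column w"
  obtains w1 w2 where "w = w1 @ w2" "fst (bump w c) = fst (bump w1 c) @ w2"
    "snd (bump w1 c) = snd (bump w c)" "length w1 = length (snd (bump w c))"
proof -
  have "\<exists>w1 w2. w = w1 @ w2 \<and> fst (bump w c) = fst (bump w1 c) @ w2 \<and>
      snd (bump w1 c) = snd (bump w c) \<and> length w1 = length (snd (bump w c))"
    using assms
  proof (induction w arbitrary: c)
    case (Cons x w)
    show ?case
    proof (cases rule: ins_cases[where x = x and c = c])
      case append
      \<comment> \<open>Once a letter has passed the whole column, so does every later one: it can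
        stand below \<open>x\<close>, hence below all of \<open>c\<close>.\<close>
      have "bump w ((c @ [x]) @ []) = (c @ x # w, [])"
        using Cons.prems append(1) by (subst bump_skip) (auto simp: bump_Nil intro: col_trans)
      with append show ?thesis by (intro exI[of _ "[]"] exI[of _ "x # w"]) simp
    next
      case (bump E y D)
      obtain w1 w2 where "w = w1 @ w2" "fst (bump w (E @ x # D)) = fst (bump w1 (E @ x # D)) @ w2"
        "snd (bump w1 (E @ x # D)) = snd (bump w (E @ x # D))"
        "length w1 = length (snd (bump w (E @ x # D)))"
        using Cons.IH[of "E @ x # D"] Cons.prems by auto
      with bump show ?thesis by (intro exI[of _ "x # w1"] exI[of _ w2]) simp
    qed
  qed simp
  with that show thesis by blast
qed

text \<open>Reverse bumping: in the new column the letters \<open>z\<close> with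
  \<open>row z y\<close> form an initial segment, and its last letter is the one that displaced
  \<open>y\<close>.\<close>

lemma ins_inj:
  assumes "column c" "column c'" "ins x c = (e, [y])" "ins x' c' = (e, [y])"
  shows "x = x' \<and> c = c'"
proof -
  have *: "e = takeWhile (\<lambda>z. row z y) e @ dropWhile (\<lambda>z. row z y) e \<and>
      x = last (takeWhile (\<lambda>z. row z y) e) \<and>
      c = butlast (takeWhile (\<lambda>z. row z y) e) @ y # dropWhile (\<lambda>z. row z y) e"
    if "column c" "ins x c = (e, [y])" for x c
  proof (cases rule: ins_cases[where x = x and c = c])
    case (bump E y' D)
    with that have "\<forall>z\<in>set (E @ [x]). row z y" "\<forall>z\<in>set D. col z y"
      by (auto dest: mixed)
    then have "takeWhile (\<lambda>z. row z y) (E @ x # D) = E @ [x]"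
      "dropWhile (\<lambda>z. row z y) (E @ x # D) = D"
      by (cases D; auto simp: takeWhile_append dropWhile_append)+
    with bump that show ?thesis by simp
  qed (use that in auto)
  from *[OF assms(1,3)] *[OF assms(2,4)] show ?thesis by metis
qed

text \<open>As many letters are bumped as inserted, so counting shows that each single insertion
  bumps exactly one. The last insertion can then be undone by \<open>ins_inj\<close>.\<close>

lemma bump_inj_full:
  assumes "column w" "column w'" "column c" "column c'" "bump w c = bump w' c'"
    and "length w = length (snd (bump w c))" "length w' = length w"
  shows "w = w' \<and> c = c'"
  using assms
proof (induction w arbitrary: w' c c' rule: rev_induct)
  case (snoc x w)
  from snoc.prems(7) obtain v x' where w': "w' = v @ [x']" by (cases w' rule: rev_cases) auto
  define e e' where "e = fst (bump w c)" and "e' = fst (bump v c')"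
  have col: "column w" "column v" "column e" "column e'"
    using snoc.prems w' by (simp_all add: e_def e'_def column_fst_bump)
  have le: "length (snd (bump w c)) \<le> length w" "length (snd (bump v c')) \<le> length v"
    using col by (simp_all add: length_snd_bump)
  have eq: "fst (ins x e) = fst (ins x' e')"
    "snd (bump w c) @ snd (ins x e) = snd (bump v c') @ snd (ins x' e')"
    using snoc.prems(5) w' by (simp_all add: e_def e'_def bump_append)
  have len: "length v = length w"
    "length (snd (bump w c)) + length (snd (ins x e)) = Suc (length w)"
    using snoc.prems(6,7) w' by (simp_all add: e_def bump_append)
  moreover from this have "length (snd (bump v c')) + length (snd (ins x' e')) = Suc (length v)"
    using arg_cong[OF eq(2), of length] by simp
  moreover have "length (snd (ins x e)) \<le> 1" "length (snd (ins x' e')) \<le> 1"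
    using snd_ins[of x e] snd_ins[of x' e'] by auto
  ultimately have one: "length (snd (ins x e)) = 1" "length (snd (ins x' e')) = 1"
    using le by linarith+
  with eq(2) have "snd (bump w c) = snd (bump v c') \<and> snd (ins x e) = snd (ins x' e')"
    by (intro append_eq_append_conv[THEN iffD1]) auto
  with eq(1) have "snd (bump w c) = snd (bump v c')" "ins x e = ins x' e'"
    by (simp_all add: prod_eq_iff)
  moreover obtain y where "ins x e = (fst (ins x e), [y])"
    using one snd_ins[of x e] by (auto simp: prod_eq_iff)
  ultimately have "x = x'" "e = e'" using ins_inj[OF col(3,4)] by metis+
  with \<open>snd (bump w c) = snd (bump v c')\<close> have "bump w c = bump v c'"
    by (simp add: prod_eq_iff e_def e'_def)
  moreover have "length w = length (snd (bump w c))"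
    using len one by simp
  ultimately have "w = v \<and> c = c'"
    using snoc.IH[of v c c'] col snoc.prems(3,4) len by simp
  with w' \<open>x = x'\<close> show ?case by simp
qed auto

text \<open>\<open>bump_split\<close> cuts off the letters that merely lengthen the column; equal
  lengths of \<open>c\<close> and \<open>c'\<close> make the two cuts agree, which leaves the case
  of \<open>bump_inj_full\<close>.\<close>

lemma bump_inj:
  assumes "column w" "column w'" "column c" "column c'" "bump w c = bump w' c'"
    and "length c = length c'"
  shows "w = w' \<and> c = c'"
proof -
  obtain w1 w2 where w: "w = w1 @ w2" "fst (bump w c) = fst (bump w1 c) @ w2"
    "snd (bump w1 c) = snd (bump w c)" "length w1 = length (snd (bump w c))"
    using assms(1) by (rule bump_split)
  obtain v1 v2 where v: "w' = v1 @ v2" "fst (bump w' c') = fst (bump v1 c') @ v2"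
    "snd (bump v1 c') = snd (bump w' c')" "length v1 = length (snd (bump w' c'))"
    using assms(2) by (rule bump_split)
  have "length (fst (bump w1 c)) = length c" "length (fst (bump v1 c')) = length c'"
    using bump_length[of w1 c] bump_length[of v1 c'] w v by simp_all
  with w v assms(5,6) have "fst (bump w1 c) = fst (bump v1 c')" "w2 = v2"
    by auto
  with w v assms bump_inj_full[of w1 v1 c c'] show ?thesis
    by (simp add: prod_eq_iff)
qed

text \<open>One step of reverse bumping, for the letter \<open>y\<close> bumped last. The final
  clause serves the iteration: the letters extracted afterwards satisfy its premise, so
  \<open>x\<close> may follow them in an increasing word.\<close>

lemma unins:
  assumes "column d" "column (w @ [y])" "tab d (w @ [y])"
  obtains x c where "column c" "ins x c = (d, [y])" "tab c w" "length c = length d"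
    "\<forall>a\<in>set c. (\<exists>b\<in>set w. row a b) \<longrightarrow> col x a"
proof -
  have row_y: "row a y" if "row a b" "b = y \<or> col y b" for a b
    using that col_trans by blast
  define P D where "P = takeWhile (\<lambda>z. row z y) d" and "D = dropWhile (\<lambda>z. row z y) d"
  have "length d > 0" "row (d ! 0) ((w @ [y]) ! 0)"
    using assms(3) by (auto simp: tab_def)
  moreover have "(w @ [y]) ! 0 = y \<or> col y ((w @ [y]) ! 0)"
    using assms(2) by (cases w) auto
  ultimately have "P \<noteq> []"
    using row_y by (cases d) (auto simp: P_def)
  then obtain E x where P: "P = E @ [x]" by (cases P rule: rev_cases) auto
  have d: "d = E @ x # D"
    using P takeWhile_dropWhile_id[of "\<lambda>z. row z y" d] by (simp add: P_def D_def)
  have rows: "row z y" if "z \<in> set P" for z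
    using that unfolding P_def by (metis set_takeWhileD)
  have cols: "col z y" if "z \<in> set D" for z
  proof -
    from that have "D \<noteq> []" by auto
    then have "col (hd D) y" using hd_dropWhile[of "\<lambda>z. row z y" d] by (simp add: D_def)
    moreover have "z = hd D \<or> col z (hd D)"
      using that assms(1) d by (cases D) auto
    ultimately show ?thesis using col_trans by blast
  qed
  have x: "row x y" "\<And>e. e \<in> set E \<Longrightarrow> col x e" "\<And>e. e \<in> set E \<Longrightarrow> col y e"
    using rows assms(1) d P mixed(2)[of x _ y] by auto
  define c where "c = E @ y # D"
  \<comment> \<open>\<open>y\<close> returns to row \<open>length E\<close>, and \<open>w\<close>
    has to end above it. Otherwise the top letter of \<open>D\<close> would stand left of a letter
    of \<open>w @ [y]\<close>, which forces its row relation to \<open>y\<close>, against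
    \<open>cols\<close>.\<close>
  have "length w \<le> length E"
  proof (rule ccontr)
    assume *: "\<not> length w \<le> length E"
    define b where "b = (w @ [y]) ! Suc (length E)"
    have **: "Suc (length E) < length (w @ [y])" using * by simp
    then have "row (d ! Suc (length E)) b" and "D \<noteq> []"
      using assms(3) d by (auto simp: tab_def b_def)
    then have "row (D ! 0) b" "D ! 0 \<in> set D" by (auto simp: d nth_append)
    moreover have "b = y \<or> col y b"
      using assms(2) ** by (auto simp: b_def nth_append)
    ultimately show False using cols row_y by blast
  qed
  show thesis
  proof
    show "column c" using assms(1) x cols by (auto simp: c_def d)
    show "ins x c = (d, [y])"
      using x ins_skip[of E x "y # D"] by (simp add: c_def d)
    have "row (c ! i) (w ! i)" if "i < length w" for i
    proof -
      have "row (d ! i) ((w @ [y]) ! i)" using assms(3) that by (simp add: tab_def)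
      with that \<open>length w \<le> length E\<close> show ?thesis by (simp add: c_def d nth_append)
    qed
    with \<open>length w \<le> length E\<close> show "tab c w" by (simp add: tab_def c_def)
    show "length c = length d" by (simp add: c_def d)
    show "\<forall>a\<in>set c. (\<exists>b\<in>set w. row a b) \<longrightarrow> col x a"
    proof (intro ballI impI)
      fix a assume a: "a \<in> set c" "\<exists>b\<in>set w. row a b"
      then obtain b where b: "b \<in> set w" "row a b" by blast
      with assms(2) have "col y b" by simp
      with b row_y have "row a y" "a \<noteq> y" by blast+
      with a(1) cols x(2) show "col x a" by (auto simp: c_def)
    qed
  qed
qed

lemma bump_surj_full:
  assumes "column d" "column w'" "tab d w'"
  obtains w c where "column w" "column c" "bump w c = (d, w')" "length c = length d"
proof -
  have "\<exists>w c. column w \<and> column c \<and> bump w c = (d, w') \<and> length c = length d \<and> length w = length w'"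
    using assms
  proof (induction w' arbitrary: d rule: rev_induct)
    case Nil
    then show ?case by (intro exI[of _ "[]"] exI[of _ d]) simp
  next
    case (snoc y w')
    obtain x e where e: "column e" "ins x e = (d, [y])" "tab e w'" "length e = length d"
      "\<forall>a\<in>set e. (\<exists>b\<in>set w'. row a b) \<longrightarrow> col x a"
      using snoc.prems by (rule unins)
    obtain w c where w: "column w" "column c" "bump w c = (e, w')" "length c = length e"
      "length w = length w'"
      using snoc.IH[OF e(1) _ e(3)] snoc.prems by auto
    have "col x a" if "a \<in> set w" for a
    proof -
      from that obtain i where i: "i < length w" "a = w ! i" by (auto simp: in_set_conv_nth)
      then have "row a (w' ! i)" using row_snd_bump[of w i c] w by simp
      moreover have "a \<in> set e" using subset_fst_bump[of w c] w that by auto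
      ultimately show ?thesis using e(5) i w(5) by auto
    qed
    with w e show ?case
      by (intro exI[of _ "w @ [x]"] exI[of _ c]) (simp add: bump_append)
  qed
  with that show thesis by blast
qed

text \<open>The entries of \<open>d\<close> after the first \<open>m\<close> must have been
  appended, so they are given back to the end of the inserted word; the rest is unbumped with the
  length kept.\<close>

lemma bump_surj:
  assumes "column d" "column w'" "tab d w'" "length w' \<le> m" "m \<le> length d"
  obtains w c where "column w" "column c" "bump w c = (d, w')" "length c = m"
proof -
  define d1 d2 where "d1 = take m d" and "d2 = drop m d"
  have d: "d = d1 @ d2" "length d1 = m" using assms(5) by (simp_all add: d1_def d2_def)
  with assms have "column d1" "column d2" "tab d1 w'" by (auto simp: tab_def nth_append)
  then obtain w c where w: "column w" "column c" "bump w c = (d1, w')" "length c = length d1"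
    using bump_surj_full assms(2) by metis
  have "bump d2 (d1 @ []) = (d, [])"
    using d assms(1) by (subst bump_skip) (auto simp: bump_Nil)
  with w d have "bump (w @ d2) c = (d, w')" by (simp add: bump_append)
  moreover have "column (w @ d2)"
    using subset_fst_bump[OF w(1), of c] w d assms(1) by auto
  ultimately show thesis using that[of "w @ d2" c] w d by auto
qed


section \<open>Pushing an increasing word through a tableau\<close>

fun push :: "'a list \<Rightarrow> 'a list list \<Rightarrow> 'a list list" where
  "push w [] = [w]"
| "push w (c # cs) = fst (bump w c) # push (snd (bump w c)) cs"

definition tableau :: "'a list list \<Rightarrow> bool" where
  "tableau cs \<longleftrightarrow> (\<forall>c\<in>set cs. column c) \<and> successively tab cs"

definition first_column :: "'a list list \<Rightarrow> 'a list" where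
  "first_column cs = (case cs of [] \<Rightarrow> [] | c # _ \<Rightarrow> c)"

lemma first_column_simps [simp]: "first_column [] = []" "first_column (c # cs) = c"
  by (simp_all add: first_column_def)

lemma tableau_simps [simp]:
  "tableau []"
  "tableau (c # cs) \<longleftrightarrow> column c \<and> tab c (first_column cs) \<and> tableau cs"
  by (simp add: tableau_def, cases cs) (auto simp: tableau_def)

lemma column_first_column: "tableau cs \<Longrightarrow> column (first_column cs)"
  by (cases cs) auto

lemma first_column_push: "column w \<Longrightarrow> first_column (push w cs) = fst (bump w (first_column cs))"
  by (cases cs) (auto simp: bump_Nil)

lemma mset_push: "mset (concat (push w cs)) = mset w + mset (concat cs)"
proof (induction cs arbitrary: w)
  case (Cons c cs)
  then show ?case using bump_mset[of w c] by (simp flip: add.assoc)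
qed simp

lemma tableau_push: "column w \<Longrightarrow> tableau cs \<Longrightarrow> tableau (push w cs)"
proof (induction cs arbitrary: w)
  case (Cons c cs)
  then show ?case
    using tab_bump[of c "first_column cs" w]
    by (auto simp: column_fst_bump column_snd_bump first_column_push column_first_column)
qed simp

lemma interlaces_push:
  "column w \<Longrightarrow> tableau cs \<Longrightarrow> interlaces (map length (push w cs)) (map length cs)"
proof (induction cs arbitrary: w)
  case (Cons c cs)
  define ds where "ds = push (snd (bump w c)) cs"
  have c: "column c" "column (first_column cs)" "tab c (first_column cs)" "tableau cs"
    using Cons.prems by (auto simp: column_first_column)
  have w': "column (snd (bump w c))"
    using Cons.prems by (simp add: column_snd_bump)
  have "length (first_column ds) \<le> length c"
  proof -
    \<comment> \<open>Only \<open>w1\<close> influences the columns to the right, and its insertion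
      keeps the first column at \<open>length c\<close>. Hence \<open>tab_bump\<close> for
      \<open>w1\<close>, rather than for \<open>w\<close>, gives the required bound.\<close>
    obtain w1 w2 where w1: "fst (bump w c) = fst (bump w1 c) @ w2"
      "snd (bump w1 c) = snd (bump w c)" "length w1 = length (snd (bump w c))"
      using Cons.prems(1) by (rule bump_split)
    have "length (first_column ds) \<le> length (fst (bump w1 c))"
      using tab_bump[OF c(1-3), of w1] w' by (simp add: w1 ds_def first_column_push tab_def)
    also have "\<dots> = length c"
      using bump_length[of w1 c] w1 by simp
    finally show ?thesis .
  qed
  moreover have "ds \<noteq> []" by (cases cs) (auto simp: ds_def)
  ultimately show ?case
    using Cons.IH[OF w' c(4)] length_bump[of c w] by (cases ds) (auto simp: ds_def[symmetric])
qed simp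

lemma push_inj:
  assumes "push w cs = push w' cs'" "map length cs = map length cs'"
    and "column w" "column w'" "tableau cs" "tableau cs'"
  shows "w = w' \<and> cs = cs'"
  using assms
proof (induction cs arbitrary: w w' cs')
  case (Cons c cs)
  from Cons.prems(2) obtain c' es where cs': "cs' = c' # es" by (cases cs') auto
  with Cons.prems have eq: "fst (bump w c) = fst (bump w' c')"
    "push (snd (bump w c)) cs = push (snd (bump w' c')) es"
    "map length cs = map length es" "length c = length c'" and col: "column c" "column c'"
    by simp_all
  have "snd (bump w c) = snd (bump w' c') \<and> cs = es"
    using Cons.prems cs' eq by (intro Cons.IH) (auto simp: column_snd_bump)
  moreover from this eq have "bump w c = bump w' c'" by (simp add: prod_eq_iff)
  ultimately show ?case
    using bump_inj[OF Cons.prems(3,4) col] eq cs' by simp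
qed simp

text \<open>The columns are restored from the right: undoing the push on the tail yields the word
  \<open>w\<close> that the first column has to emit, and \<open>bump_surj\<close> then finds that
  column with the prescribed length \<open>l\<close>.\<close>

lemma push_surj:
  assumes "tableau ds" "interlaces (map length ds) ls"
  obtains w cs where "column w" "tableau cs" "map length cs = ls" "push w cs = ds"
proof -
  have "\<exists>w cs. column w \<and> tableau cs \<and> map length cs = ls \<and> push w cs = ds"
    using assms
  proof (induction ls arbitrary: ds)
    case Nil
    then obtain d where "ds = [d]" by (cases ds; cases "tl ds") auto
    with Nil show ?case by (intro exI[of _ d] exI[of _ "[]"]) simp
  next
    case (Cons l ls)
    then obtain d d2 ds' where ds: "ds = d # d2 # ds'"
      by (cases ds; cases "tl ds") auto
    with Cons.prems have "tableau (d2 # ds')" "interlaces (map length (d2 # ds')) ls"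
      by simp_all
    from Cons.IH[OF this] obtain w cs where w: "column w" "tableau cs" "map length cs = ls" "push w cs = d2 # ds'"
      by blast
    define c2 where "c2 = first_column cs"
    have c2: "column c2" "fst (bump w c2) = d2"
      using w first_column_push[of w cs] by (simp_all add: c2_def column_first_column)
    have len: "length w \<le> length d2"
      using length_snd_bump(1)[OF w(1), of c2] bump_length[of w c2] c2 by simp
    \<comment> \<open>\<open>d2 ! i\<close> may stand right of \<open>d ! i\<close>, and
      \<open>w ! i\<close> equals \<open>d2 ! i\<close> or may stand below it in a column, so the
      row condition passes from \<open>d2\<close> to \<open>w\<close>.\<close>
    have "tab d w"
      unfolding tab_def
    proof (intro conjI allI impI)
      show "length w \<le> length d" using len Cons.prems ds by simp
      fix i assume i: "i < length w"
      with len Cons.prems ds have "row (d ! i) (d2 ! i)" by (auto simp: tab_def)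
      with fst_bump_nth[OF w(1) i, of c2] c2 show "row (d ! i) (w ! i)"
        using col_trans by auto
    qed
    moreover have "column d" "length w \<le> l" "l \<le> length d"
      using Cons.prems ds len by auto
    ultimately obtain v c where v: "column v" "column c" "bump v c = (d, w)" "length c = l"
      using bump_surj w(1) by metis
    have "tab c c2"
      using tab_bump_rev[of c c2 v] v c2 Cons.prems ds by simp
    with v w show ?case
      by (intro exI[of _ v] exI[of _ "c # cs"]) (simp add: c2_def ds)
  qed
  with that show thesis by blast
qed

lemma bij_betw_push:
  "bij_betw (\<lambda>(w, cs). push w cs)
     {(w, cs). column w \<and> length w = k \<and> tableau cs \<and> map length cs = ls \<and>
        set w \<subseteq> A \<and> set (concat cs) \<subseteq> A}
     {ds. tableau ds \<and> interlaces (map length ds) ls \<and> sum_list (map length ds) = k + sum_list ls \<and>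
        set (concat ds) \<subseteq> A}"
    (is "bij_betw _ ?S ?T")
proof (rule bij_betw_imageI)
  have set_push: "set (concat (push w cs)) = set w \<union> set (concat cs)" for w cs
    using arg_cong[OF mset_push[of w cs], of set_mset] by simp
  have len_push: "sum_list (map length (push w cs)) = length w + sum_list (map length cs)" for w cs
    using arg_cong[OF mset_push[of w cs], of size] by (simp add: length_concat)
  show "inj_on (\<lambda>(w, cs). push w cs) ?S"
    using push_inj by (auto simp: inj_on_def)
  show "(\<lambda>(w, cs). push w cs) ` ?S = ?T"
  proof (intro equalityI subsetI)
    fix ds assume "ds \<in> (\<lambda>(w, cs). push w cs) ` ?S"
    then obtain w cs where ds: "ds = push w cs" "(w, cs) \<in> ?S" by auto
    with tableau_push[of w cs] interlaces_push[of w cs] set_push[of w cs] len_push[of w cs]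
    show "ds \<in> ?T" by auto
  next
    fix ds assume ds: "ds \<in> ?T"
    then have "tableau ds" "interlaces (map length ds) ls" by auto
    then obtain w cs where w: "column w" "tableau cs" "map length cs = ls" "push w cs = ds"
      by (rule push_surj)
    with ds set_push[of w cs] len_push[of w cs] have "(w, cs) \<in> ?S" by auto
    with w show "ds \<in> (\<lambda>(w, cs). push w cs) ` ?S" by force
  qed
qed

end

section \<open>The plactic algebra\<close>

locale shuffle =
  fixes N :: nat and lt :: "letter \<Rightarrow> letter \<Rightarrow> bool"
  assumes shuffle_order: "shuffle_order N lt"
begin

abbreviation alph :: "letter set" where "alph \<equiv> alphabet N"
abbreviation U :: "word_poly ring" where "U \<equiv> free_alg N"

lemma lt_order:
  "x \<in> alph \<Longrightarrow> \<not> lt x x"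
  "x \<in> alph \<Longrightarrow> y \<in> alph \<Longrightarrow> z \<in> alph \<Longrightarrow> lt x y \<Longrightarrow> lt y z \<Longrightarrow> lt x z"
  "x \<in> alph \<Longrightarrow> y \<in> alph \<Longrightarrow> x \<noteq> y \<Longrightarrow> lt x y \<or> lt y x"
  using shuffle_order unfolding shuffle_order_def
  by (auto dest: irreflp_onD transp_onD totalp_onD)

text \<open>
  Letters outside the alphabet form a class above all others, so that the order axioms hold on
  the whole type.
\<close>

definition col :: "letter \<Rightarrow> letter \<Rightarrow> bool" where
  "col x y \<longleftrightarrow> x \<notin> alph \<or> y \<in> alph \<and> col_ge lt x y"

sublocale bumping col
proof
  show "col x z" if "col x y" "col y z" for x y z
    using that lt_order unfolding col_def col_ge_def by metis
  show "\<not> col x z" if "\<not> col x y" "\<not> col y z" for x y z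
    using that lt_order unfolding col_def col_ge_def by metis
qed

section \<open>Congruence modulo the plactic ideal\<close>

lemma carrier_simps:
  "0 \<in> carrier U" "1 \<in> carrier U"
  "p \<in> carrier U \<Longrightarrow> q \<in> carrier U \<Longrightarrow> p + q \<in> carrier U"
  "p \<in> carrier U \<Longrightarrow> q \<in> carrier U \<Longrightarrow> p * q \<in> carrier U"
  "p \<in> carrier U \<Longrightarrow> - p \<in> carrier U"
proof -
  interpret ring U by (rule ring_free_alg)
  have ops: "mult U = (*)" "monoid.one U = 1" "ring.zero U = 0" "add U = (+)"
    by (simp_all add: free_alg_def)
  show "0 \<in> carrier U" "1 \<in> carrier U"
    "p \<in> carrier U \<Longrightarrow> q \<in> carrier U \<Longrightarrow> p + q \<in> carrier U"
    "p \<in> carrier U \<Longrightarrow> q \<in> carrier U \<Longrightarrow> p * q \<in> carrier U"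
    using zero_closed one_closed add.m_closed m_closed by (simp_all add: ops)
  show "p \<in> carrier U \<Longrightarrow> - p \<in> carrier U" by (simp add: free_alg_def)
qed

lemma carrier_word: "set w \<subseteq> alph \<Longrightarrow> word_mon w \<in> carrier U"
  by (simp add: free_alg_def word_mon_def)

lemma carrier_sum: "(\<And>x. x \<in> X \<Longrightarrow> f x \<in> carrier U) \<Longrightarrow> sum f X \<in> carrier U"
  by (induction X rule: infinite_finite_induct) (auto intro: carrier_simps)

lemma carrier_prod_list: "set ps \<subseteq> carrier U \<Longrightarrow> prod_list ps \<in> carrier U"
  by (induction ps) (auto intro: carrier_simps)

lemma plac_ideal: "ideal (plac_ideal N lt) U"
  unfolding plac_ideal_def by (intro ring.genideal_ideal ring_free_alg plac_gens_subset)

lemma a_minus: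
  assumes "p \<in> carrier U" "q \<in> carrier U"
  shows "p \<ominus>\<^bsub>U\<^esub> q = p - q"
proof -
  interpret ring U by (rule ring_free_alg)
  have "\<ominus>\<^bsub>U\<^esub> q = - q"
    using assms carrier_simps(5)[of q] by (intro minus_equality) (auto simp: free_alg_def)
  then show ?thesis by (simp add: a_minus_def free_alg_def)
qed

definition cong :: "word_poly \<Rightarrow> word_poly \<Rightarrow> bool" (infix "\<approx>" 50) where
  "p \<approx> q \<longleftrightarrow> p \<in> carrier U \<and> q \<in> carrier U \<and> p - q \<in> plac_ideal N lt"

lemma cong_iff_cosets:
  "p \<in> carrier U \<Longrightarrow> q \<in> carrier U \<Longrightarrow>
    p \<approx> q \<longleftrightarrow> plac_ideal N lt +>\<^bsub>U\<^esub> p = plac_ideal N lt +>\<^bsub>U\<^esub> q"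
  using ring.quotient_eq_iff_same_a_r_cos[OF ring_free_alg plac_ideal, of p q]
  by (simp add: cong_def a_minus)

lemma cong_carrier: "p \<approx> q \<Longrightarrow> p \<in> carrier U" "p \<approx> q \<Longrightarrow> q \<in> carrier U"
  by (simp_all add: cong_def)

lemma ideal_closed:
  "0 \<in> plac_ideal N lt"
  "p \<in> plac_ideal N lt \<Longrightarrow> q \<in> plac_ideal N lt \<Longrightarrow> p + q \<in> plac_ideal N lt"
  "p \<in> plac_ideal N lt \<Longrightarrow> q \<in> carrier U \<Longrightarrow> p * q \<in> plac_ideal N lt"
  "p \<in> plac_ideal N lt \<Longrightarrow> q \<in> carrier U \<Longrightarrow> q * p \<in> plac_ideal N lt"
  "p \<in> plac_ideal N lt \<Longrightarrow> - p \<in> plac_ideal N lt"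
proof -
  interpret ideal "plac_ideal N lt" U by (rule plac_ideal)
  have ops: "mult U = (*)" "ring.zero U = 0" "add U = (+)"
    by (simp_all add: free_alg_def)
  show "0 \<in> plac_ideal N lt"
    "p \<in> plac_ideal N lt \<Longrightarrow> q \<in> plac_ideal N lt \<Longrightarrow> p + q \<in> plac_ideal N lt"
    "p \<in> plac_ideal N lt \<Longrightarrow> q \<in> carrier U \<Longrightarrow> p * q \<in> plac_ideal N lt"
    "p \<in> plac_ideal N lt \<Longrightarrow> q \<in> carrier U \<Longrightarrow> q * p \<in> plac_ideal N lt"
    using additive_subgroup.zero_closed[OF additive_subgroup_axioms]
      additive_subgroup.a_closed[OF additive_subgroup_axioms] I_r_closed I_l_closed
    by (simp_all add: ops)
  show "- p \<in> plac_ideal N lt" if "p \<in> plac_ideal N lt"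
    using I_r_closed[OF that, of "- 1"] carrier_simps(5)[OF carrier_simps(2)] by (simp add: ops)
qed

lemma cong_refl: "p \<in> carrier U \<Longrightarrow> p \<approx> p"
  by (simp add: cong_def ideal_closed)

lemma cong_sym: "p \<approx> q \<Longrightarrow> q \<approx> p"
  using ideal_closed(5)[of "p - q"] by (simp add: cong_def)

lemma cong_trans [trans]: "p \<approx> q \<Longrightarrow> q \<approx> r \<Longrightarrow> p \<approx> r"
  using ideal_closed(2)[of "p - q" "q - r"] by (simp add: cong_def)

lemma cong_add: "p \<approx> q \<Longrightarrow> r \<approx> s \<Longrightarrow> p + r \<approx> q + s"
  using ideal_closed(2)[of "p - q" "r - s"] by (simp add: cong_def carrier_simps algebra_simps)

lemma cong_mult:
  assumes "p \<approx> q" "r \<approx> s"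
  shows "p * r \<approx> q * s"
proof -
  have "(p - q) * r + q * (r - s) \<in> plac_ideal N lt"
    using assms by (intro ideal_closed) (auto simp: cong_def)
  then show ?thesis using assms by (simp add: cong_def carrier_simps algebra_simps)
qed

lemma cong_sum: "(\<And>x. x \<in> X \<Longrightarrow> f x \<approx> g x) \<Longrightarrow> sum f X \<approx> sum g X"
  by (induction X rule: infinite_finite_induct) (auto intro: cong_add cong_refl carrier_simps)

lemma cong_word_context:
  assumes "word_mon v \<approx> word_mon w" "set p \<subseteq> alph" "set q \<subseteq> alph"
  shows "word_mon (p @ v @ q) \<approx> word_mon (p @ w @ q)"
  using assms by (simp add: word_mon_append cong_mult cong_refl carrier_word)

lemma cong_gen:
  assumes "word_mon v - word_mon w \<in> plac_gens N lt" "set v \<subseteq> alph" "set w \<subseteq> alph"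
  shows "word_mon v \<approx> word_mon w"
proof -
  have "plac_gens N lt \<subseteq> plac_ideal N lt"
    unfolding plac_ideal_def by (intro ring.genideal_self ring_free_alg plac_gens_subset)
  with assms show ?thesis by (auto simp: cong_def carrier_word)
qed

section \<open>Knuth relations and reading words\<close>

lemma plac_gensI:
  "{x,y,z} \<subseteq> alph \<Longrightarrow> lt x y \<Longrightarrow> lt y z \<Longrightarrow> word_mon [x,z,y] - word_mon [z,x,y] \<in> plac_gens N lt"
  "{x,y,z} \<subseteq> alph \<Longrightarrow> lt x y \<Longrightarrow> lt y z \<Longrightarrow> word_mon [y,x,z] - word_mon [y,z,x] \<in> plac_gens N lt"
  "{x,y} \<subseteq> alph \<Longrightarrow> \<not> barred y \<Longrightarrow> lt x y \<Longrightarrow> word_mon [y,y,x] - word_mon [y,x,y] \<in> plac_gens N lt"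
  "{y,z} \<subseteq> alph \<Longrightarrow> \<not> barred y \<Longrightarrow> lt y z \<Longrightarrow> word_mon [z,y,y] - word_mon [y,z,y] \<in> plac_gens N lt"
  "{y,z} \<subseteq> alph \<Longrightarrow> barred y \<Longrightarrow> lt y z \<Longrightarrow> word_mon [y,y,z] - word_mon [y,z,y] \<in> plac_gens N lt"
  "{x,y} \<subseteq> alph \<Longrightarrow> barred y \<Longrightarrow> lt x y \<Longrightarrow> word_mon [x,y,y] - word_mon [y,x,y] \<in> plac_gens N lt"
  unfolding plac_gens_def by blast+

text \<open>Since \<open>row x y\<close> admits equal unbarred letters and \<open>col z y\<close>
  equal barred ones, this unites the families xzy - zxy, zyy - yzy and xyy - yxy. The other three
  are united in \<open>knuth2\<close>.\<close>

lemma knuth1: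
  assumes "{x, y, z} \<subseteq> alph" "row x y" "col z y"
  shows "word_mon [x, z, y] \<approx> word_mon [z, x, y]"
proof -
  have xy: "lt x y \<or> x = y \<and> \<not> barred y" and yz: "lt y z \<or> y = z \<and> barred y"
    using assms lt_order(3)[of x y] by (auto simp: col_def col_ge_def)
  have xyz: "x \<in> alph" "y \<in> alph" "z \<in> alph" using assms(1) by simp_all
  consider "lt x y" "lt y z" | "x = y" "\<not> barred y" "lt y z" | "lt x y" "y = z" "barred y"
    using xy yz by blast
  then show ?thesis
  proof cases
    case 1
    show ?thesis by (rule cong_gen[OF plac_gensI(1)]) (use 1 xyz in simp_all)
  next
    case 2
    have "word_mon [z, y, y] \<approx> word_mon [y, z, y]"
      by (rule cong_gen[OF plac_gensI(4)]) (use 2 xyz in simp_all)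
    with 2 show ?thesis by (simp add: cong_sym)
  next
    case 3
    have "word_mon [x, y, y] \<approx> word_mon [y, x, y]"
      by (rule cong_gen[OF plac_gensI(6)]) (use 3 xyz in simp_all)
    with 3 show ?thesis by simp
  qed
qed

lemma knuth2:
  assumes "{x, y, z} \<subseteq> alph" "col y x" "row y z"
  shows "word_mon [y, x, z] \<approx> word_mon [y, z, x]"
proof -
  have xy: "lt x y \<or> x = y \<and> barred y" and yz: "lt y z \<or> y = z \<and> \<not> barred y"
    using assms lt_order(3)[of y z] by (auto simp: col_def col_ge_def)
  have xyz: "x \<in> alph" "y \<in> alph" "z \<in> alph" using assms(1) by simp_all
  consider "lt x y" "lt y z" | "lt x y" "y = z" "\<not> barred y" | "x = y" "barred y" "lt y z"
    using xy yz by blast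
  then show ?thesis
  proof cases
    case 1
    show ?thesis by (rule cong_gen[OF plac_gensI(2)]) (use 1 xyz in simp_all)
  next
    case 2
    have "word_mon [y, y, x] \<approx> word_mon [y, x, y]"
      by (rule cong_gen[OF plac_gensI(3)]) (use 2 xyz in simp_all)
    with 2 show ?thesis by (simp add: cong_sym)
  next
    case 3
    have "word_mon [y, y, z] \<approx> word_mon [y, z, y]"
      by (rule cong_gen[OF plac_gensI(5)]) (use 3 xyz in simp_all)
    with 3 show ?thesis by simp
  qed
qed

text \<open>\<open>x\<close> travels to the right past the letters of \<open>D\<close>, one use of
  \<open>knuth1\<close> for each; the letter after the one being passed is the third letter of the
  relation.\<close>

lemma cong_insert_above:
  assumes "set (x # y # D) \<subseteq> alph" "column (y # D)" "row x y"
  shows "word_mon (x # rev D @ [y]) \<approx> word_mon (rev D @ [x, y])"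
  using assms
proof (induction D rule: rev_induct)
  case Nil
  then show ?case by (simp add: cong_refl carrier_word)
next
  case (snoc d D)
  obtain e D' where e: "rev D @ [y] = e # D'" by (cases "rev D") auto
  then have "set (rev D @ [y]) = set (e # D')" by (simp only:)
  then have sets: "insert e (set D') = insert y (set D)" by auto
  then have "e = y \<or> e \<in> set D" by blast
  with snoc.prems(1,2) have "col d e" "e = y \<or> col e y" "e \<in> alph" by auto
  moreover from this(2) have "row x e" using snoc.prems(3) col_trans[of x e y] by auto
  ultimately have "word_mon [x, d, e] \<approx> word_mon [d, x, e]"
    using snoc.prems(1) by (intro knuth1) auto
  moreover have "set D' \<subseteq> alph"
    using sets snoc.prems(1) by auto
  ultimately have "word_mon (x # d # rev D @ [y]) \<approx> word_mon (d # x # rev D @ [y])"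
    using cong_word_context[of "[x, d, e]" "[d, x, e]" "[]" D'] unfolding e by simp
  also have "\<dots> \<approx> word_mon (d # rev D @ [x, y])"
    using cong_word_context[OF snoc.IH, of "[d]" "[]"] snoc.prems by simp
  finally show ?case by simp
qed

lemma cong_ins:
  assumes "set (x # c) \<subseteq> alph" "column c"
  shows "word_mon (x # rev c) \<approx> word_mon (rev (fst (ins x c)) @ snd (ins x c))"
  using assms
proof (induction c)
  case Nil
  then show ?case by (simp add: cong_refl carrier_word)
next
  case (Cons y c)
  show ?case
  proof (cases "row x y")
    case True
    with cong_insert_above[of x y c] Cons.prems show ?thesis by simp
  next
    case False
    have IH: "word_mon (x # rev c @ [y]) \<approx> word_mon (rev (fst (ins x c)) @ snd (ins x c) @ [y])"
      using cong_word_context[OF Cons.IH, of "[]" "[y]"] Cons.prems by simp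
    show ?thesis
    proof (cases rule: ins_cases[where x = x and c = c])
      case append
      with IH False show ?thesis by simp
    next
      case (bump E z D)
      \<comment> \<open>\<open>p\<close> is the letter directly below \<open>y\<close> after the
        insertion. The induction hypothesis leaves the bumped \<open>z\<close> in front of
        \<open>y\<close>, and \<open>knuth2\<close> with \<open>p\<close> moves it behind
        \<open>y\<close>.\<close>
      define p where "p = hd (E @ [x])"
      obtain F where F: "E @ x # D = p # F" by (cases E) (auto simp: p_def)
      have "p \<in> set (E @ [x])" unfolding p_def by (rule hd_in_set) simp
      with bump False Cons.prems have "col p y" "row p z" "p \<in> alph"
        using mixed(1)[of x p z] by auto
      then have "word_mon [p, y, z] \<approx> word_mon [p, z, y]"
        using Cons.prems bump by (intro knuth2) auto
      moreover have "set (E @ x # D) = set (p # F)" by (simp only: F)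
      then have "set F \<subseteq> alph" using bump(1) Cons.prems(1) by auto
      ultimately have F': "word_mon (rev F @ [p, y, z]) \<approx> word_mon (rev F @ [p, z, y])"
        using cong_word_context[of "[p, y, z]" "[p, z, y]" "rev F" "[]"] by simp
      have "ins x c = (p # F, [z])" "ins x (y # c) = (y # p # F, [z])"
        using bump(4) F False by simp_all
      then show ?thesis using cong_trans[OF IH, of "word_mon (rev F @ [p, y, z])"] cong_sym[OF F'] by simp
    qed
  qed
qed

lemma cong_bump:
  assumes "set w \<subseteq> alph" "set c \<subseteq> alph" "column c"
  shows "word_mon (rev w @ rev c) \<approx> word_mon (rev (fst (bump w c)) @ rev (snd (bump w c)))"
  using assms
proof (induction w arbitrary: c)
  case Nil
  then show ?case by (simp add: cong_refl carrier_word)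
next
  case (Cons x w)
  define e b where "e = fst (ins x c)" and "b = snd (ins x c)"
  have sets: "set e \<subseteq> alph" "set b \<subseteq> alph"
    using arg_cong[OF ins_mset[of x c], of set_mset] Cons.prems by (auto simp: e_def b_def)
  have "word_mon (rev w @ x # rev c) \<approx> word_mon (rev w @ rev e @ b)"
    using cong_word_context[OF cong_ins[of x c], of "rev w" "[]"] Cons.prems
    by (simp add: e_def b_def)
  also have "\<dots> \<approx> word_mon (rev (fst (bump w e)) @ rev (snd (bump w e)) @ b)"
    using cong_word_context[OF Cons.IH[of e], of "[]" b] Cons.prems sets
    by (simp add: e_def column_fst_ins)
  \<comment> \<open>\<open>b\<close> has at most one letter, so it is its own reversal.\<close>
  also have "rev (snd (bump w e)) @ b = rev (b @ snd (bump w e))"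
    using snd_ins[of x c] by (auto simp: b_def)
  finally show ?case by (simp add: e_def b_def)
qed

lemma cong_push:
  assumes "column w" "tableau cs" "set w \<subseteq> alph" "set (concat cs) \<subseteq> alph"
  shows "word_mon (rev w @ concat (map rev cs)) \<approx> word_mon (concat (map rev (push w cs)))"
  using assms
proof (induction cs arbitrary: w)
  case Nil
  then show ?case by (simp add: cong_refl carrier_word)
next
  case (Cons c cs)
  define d w' where "d = fst (bump w c)" and "w' = snd (bump w c)"
  have sets: "set d \<subseteq> alph" "set w' \<subseteq> alph"
    using arg_cong[OF bump_mset[of w c], of set_mset] Cons.prems by (auto simp: d_def w'_def)
  have "word_mon (rev w @ rev c @ concat (map rev cs)) \<approx>
      word_mon (rev d @ rev w' @ concat (map rev cs))"
    using cong_word_context[OF cong_bump[of w c], of "[]" "concat (map rev cs)"] Cons.prems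
    by (simp add: d_def w'_def)
  also have "\<dots> \<approx> word_mon (rev d @ concat (map rev (push w' cs)))"
    using cong_word_context[OF Cons.IH[of w'], of "rev d" "[]"] Cons.prems sets
    by (simp add: w'_def column_snd_bump)
  finally show ?case by (simp add: d_def w'_def)
qed

section \<open>Tableau sums and the Pieri rule\<close>

definition tableaux :: "nat list \<Rightarrow> letter list list set" where
  "tableaux ls = {cs. tableau cs \<and> map length cs = ls \<and> set (concat cs) \<subseteq> alph}"

text \<open>\<open>tab\<close> forces the column lengths to decrease weakly; for any other
  \<open>ls\<close> the sum is empty and has the value 0.\<close>

definition schur :: "nat list \<Rightarrow> word_poly" where
  "schur ls = (\<Sum>cs\<in>tableaux ls. word_mon (concat (map rev cs)))"

lemma finite_tableaux: "finite (tableaux ls)"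
proof (rule finite_subset)
  show "tableaux ls \<subseteq> {cs. set cs \<subseteq> {c. set c \<subseteq> alph \<and> length c \<le> sum_list ls} \<and> length cs = length ls}"
  proof
    fix cs assume "cs \<in> tableaux ls"
    then have ls: "ls = map length cs" and sub: "set (concat cs) \<subseteq> alph"
      by (auto simp: tableaux_def)
    have "length c \<le> sum_list ls" if "c \<in> set cs" for c
      using that unfolding ls by (intro member_le_sum_list) simp_all
    with ls sub show "cs \<in> {cs. set cs \<subseteq> {c. set c \<subseteq> alph \<and> length c \<le> sum_list ls} \<and>
        length cs = length ls}"
      by auto
  qed
qed (simp add: finite_lists_length_eq finite_lists_length_le finite_alphabet)

lemma successively_col_ge:
  assumes "set w \<subseteq> alph"
  shows "successively (col_ge lt) w \<longleftrightarrow> column (rev w)"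
proof -
  have "successively (col_ge lt) w \<longleftrightarrow> successively col w"
    using assms by (intro successively_cong) (auto simp: col_def)
  also have "\<dots> \<longleftrightarrow> column (rev w)"
    unfolding column_def sorted_wrt_rev
    by (intro successively_iff_sorted_wrt_strong) (blast intro: col_trans)
  finally show ?thesis .
qed

lemma elem_sym_conv:
  assumes "k \<ge> 0"
  shows "elem_sym N lt k =
    (\<Sum>c | column c \<and> length c = nat k \<and> set c \<subseteq> alph. word_mon (rev c))"
proof -
  have *: "(\<Sum>w | set w \<subseteq> alph \<and> int (length w) = k \<and> successively (col_ge lt) w. word_mon w) =
      (\<Sum>c | column c \<and> length c = nat k \<and> set c \<subseteq> alph. word_mon (rev c))"
    using assms by (intro sum.reindex_bij_witness[of _ rev rev]) (auto simp: successively_col_ge simp del: successively_rev)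
  moreover have "{c. column c \<and> c = [] \<and> set c \<subseteq> alph} = {[]}" by auto
  ultimately show ?thesis
    using assms by (simp add: elem_sym_def word_mon_Nil)
qed

lemma carrier_elem_sym: "elem_sym N lt k \<in> carrier U"
proof (cases "k \<ge> 0")
  case True
  then show ?thesis by (auto simp: elem_sym_conv intro!: carrier_sum carrier_word)
qed (simp add: elem_sym_def carrier_simps)

lemma pieri:
  "elem_sym N lt k * schur ls \<approx>
    (\<Sum>ms | interlaces ms ls \<and> int (sum_list ms) = k + int (sum_list ls). schur ms)"
    (is "_ \<approx> sum schur ?V")
proof (cases "k \<ge> 0")
  case False
  \<comment> \<open>Interlacing never lowers the size, so for negative \<open>k\<close> no shape
    remains, in agreement with the value 0 of \<open>elem_sym\<close>.\<close>
  then have V: "?V = {}" using interlaces_sum_list by fastforce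
  from False show ?thesis unfolding V by (simp add: elem_sym_def cong_refl carrier_simps)
next
  case True
  define C where "C = {c. column c \<and> length c = nat k \<and> set c \<subseteq> alph}"
  define T where "T = {ds. tableau ds \<and> interlaces (map length ds) ls \<and>
    sum_list (map length ds) = nat k + sum_list ls \<and> set (concat ds) \<subseteq> alph}"
  define rw where "rw = (\<lambda>cs :: letter list list. word_mon (concat (map rev cs)))"
  have "C \<times> tableaux ls = {(w, cs). column w \<and> length w = nat k \<and> tableau cs \<and> map length cs = ls \<and>
      set w \<subseteq> alph \<and> set (concat cs) \<subseteq> alph}"
    by (auto simp: C_def tableaux_def)
  then have bij: "bij_betw (\<lambda>(w, cs). push w cs) (C \<times> tableaux ls) T"
    unfolding T_def using bij_betw_push[of "nat k" ls alph] by simp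
  have "elem_sym N lt k * schur ls = (\<Sum>(w, cs)\<in>C \<times> tableaux ls. word_mon (rev w @ concat (map rev cs)))"
    using True by (simp add: elem_sym_conv schur_def sum_product sum.cartesian_product word_mon_append C_def)
  also have "\<dots> \<approx> (\<Sum>(w, cs)\<in>C \<times> tableaux ls. rw (push w cs))"
    unfolding rw_def by (rule cong_sum) (auto simp: C_def tableaux_def intro!: cong_push)
  also have "(\<Sum>(w, cs)\<in>C \<times> tableaux ls. rw (push w cs)) = sum rw T"
    using sum.reindex_bij_betw[OF bij, of rw] by (simp add: case_prod_unfold)
  also have "\<dots> = (\<Sum>ms\<in>?V. \<Sum>ds | ds \<in> T \<and> map length ds = ms. rw ds)"
  proof (rule sum.group[symmetric])
    show "finite T"
    proof (rule finite_subset)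
      show "T \<subseteq> (\<Union>ms\<in>?V. tableaux ms)"
        using True by (auto simp: T_def tableaux_def)
      show "finite (\<Union>ms\<in>?V. tableaux ms)"
        using finite_interlaces finite_tableaux by blast
    qed
    show "map length ` T \<subseteq> ?V" using True by (auto simp: T_def)
  qed (rule finite_interlaces)
  also have "\<dots> = sum schur ?V"
  proof (intro sum.cong refl)
    fix ms assume "ms \<in> ?V"
    with True have "{ds \<in> T. map length ds = ms} = tableaux ms"
      by (auto simp: T_def tableaux_def)
    then show "(\<Sum>ds | ds \<in> T \<and> map length ds = ms. rw ds) = schur ms"
      by (simp add: schur_def rw_def)
  qed
  finally show ?thesis .
qed

lemma schur_Nil: "schur [] = 1"
proof -
  have "tableaux [] = {[]}" by (auto simp: tableaux_def)
  then show ?thesis by (simp add: schur_def word_mon_Nil)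
qed

lemma schur_single: "schur [n] = elem_sym N lt (int n)"
proof -
  have "tableaux [n] = (\<lambda>c. [c]) ` {c. column c \<and> length c = n \<and> set c \<subseteq> alph}"
    by (auto simp: tableaux_def)
  then show ?thesis
    by (simp add: schur_def elem_sym_conv sum.reindex inj_on_def)
qed

lemma interlaces_single: "interlaces ms [l] \<longleftrightarrow> (\<exists>m m'. ms = [m, m'] \<and> l \<le> m \<and> m' \<le> l)"
  by (cases ms; cases "tl ms"; cases "tl (tl ms)") auto

text \<open>Pieri for the column \<open>[n]\<close> yields the shapes \<open>[p, q]\<close> with
  \<open>q <= n <= p\<close> and \<open>p + q = m + n\<close>. By the sum condition these bounds are
  equivalent to \<open>q <= m <= p\<close>, the bounds for the other order of the factors.\<close>

lemma elem_sym_commute: "elem_sym N lt a * elem_sym N lt b \<approx> elem_sym N lt b * elem_sym N lt a"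
proof (cases "a < 0 \<or> b < 0")
  case True
  then show ?thesis by (auto simp: elem_sym_def cong_refl carrier_simps)
next
  case False
  then obtain m n where ab: "a = int m" "b = int n"
    by (metis not_less zero_le_imp_eq_int)
  have "{ms. interlaces ms [n] \<and> int (sum_list ms) = a + int n} =
      {ms. interlaces ms [m] \<and> int (sum_list ms) = b + int m}"
    using ab by (auto simp: interlaces_single)
  with pieri[of a "[n]"] pieri[of b "[m]"] ab show ?thesis
    by (simp add: schur_single) (blast intro: cong_trans cong_sym)
qed

end

section \<open>The Jacobi-Trudi determinant\<close>

text \<open>In the matrix with index \<open>ls ! r - r + s\<close> in row \<open>r\<close> and
  column \<open>s\<close>, both counted from 0, the first column and row \<open>b\<close> are
  deleted. The column shift adds 1 to every index; for rows after \<open>b\<close> the row shift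
  absorbs it.\<close>

definition remove_column :: "nat \<Rightarrow> nat list \<Rightarrow> nat list" where
  "remove_column b ls = map Suc (take b ls) @ drop (Suc b) ls"

lemma length_remove_column [simp]: "b < length ls \<Longrightarrow> length (remove_column b ls) = length ls - 1"
  by (simp add: remove_column_def)

lemma nth_remove_column:
  "b < length ls \<Longrightarrow> j < length ls - 1 \<Longrightarrow>
    remove_column b ls ! j = (if j < b then Suc (ls ! j) else ls ! Suc j)"
  by (auto simp: remove_column_def nth_append min_def)

lemma sum_list_remove_column:
  "b < length ls \<Longrightarrow> sum_list (remove_column b ls) + ls ! b = sum_list ls + b"
proof (induction ls arbitrary: b)
  case (Cons l ls)
  show ?case
  proof (cases b)
    case (Suc k)
    with Cons.IH[of k] Cons.prems show ?thesis by (simp add: remove_column_def)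
  qed (simp add: remove_column_def)
qed simp

lemma sorted_remove_column:
  assumes "sorted_wrt (\<ge>) ls"
  shows "sorted_wrt (\<ge>) (remove_column b ls)"
proof -
  have "sorted_wrt (\<ge>) (take b ls @ drop b ls)" using assms by simp
  moreover have "set (drop (Suc b) ls) \<subseteq> set (drop b ls)"
    by (rule set_drop_subset_set_drop) simp
  ultimately have "\<forall>x\<in>set (take b ls). \<forall>y\<in>set (drop (Suc b) ls). y \<le> x"
    unfolding sorted_wrt_append by blast
  then show ?thesis
    using sorted_wrt_take[OF assms, of b] sorted_wrt_drop[OF assms, of "Suc b"]
    by (auto simp: remove_column_def sorted_wrt_append sorted_wrt_map le_SucI)
qed

lemma alternating_telescope:
  fixes x y :: "nat \<Rightarrow> 'a :: ring_1"
  assumes "\<And>b. b < m \<Longrightarrow> y (Suc b) = x b"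
  shows "(\<Sum>b<Suc m. (- 1) ^ b * (x b + y b)) = y 0 + (- 1) ^ m * x m"
  using assms by (induction m) (simp_all add: algebra_simps)

context shuffle
begin

abbreviation e :: "int \<Rightarrow> word_poly" where "e \<equiv> elem_sym N lt"

text \<open>Factor \<open>i\<close> is the entry in column \<open>i\<close> and row
  \<open>\<sigma> i\<close>. The order of the factors matters, as commutation is available only
  modulo the ideal.\<close>

definition jacobi_trudi :: "nat list \<Rightarrow> word_poly" where
  "jacobi_trudi ls = (\<Sum>\<sigma> | \<sigma> permutes {0..<length ls}. of_int (sign \<sigma>) *
     prod_list (map (\<lambda>i. e (int (ls ! \<sigma> i) - int (\<sigma> i) + int i)) [0..<length ls]))"

text \<open>An identity in the free algebra itself, since the entry of the first column is already
  the leftmost factor. \<open>permutation_insert\<close> produces the permutations with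
  \<open>\<sigma> 0 = b\<close> from those of \<open>m\<close> points.\<close>

lemma jacobi_trudi_expand:
  assumes "length ls = Suc m"
  shows "jacobi_trudi ls =
    (\<Sum>b<Suc m. (- 1) ^ b * (e (int (ls ! b) - int b) * jacobi_trudi (remove_column b ls)))"
proof -
  define P where "P n = {\<sigma>. \<sigma> permutes {0..<n}}" for n :: nat
  define f where "f \<sigma> = of_int (sign \<sigma>) *
     prod_list (map (\<lambda>i. e (int (ls ! \<sigma> i) - int (\<sigma> i) + int i)) [0..<Suc m])" for \<sigma>
  have fin: "finite (P n)" for n unfolding P_def by (intro finite_permutations) simp
  have "jacobi_trudi ls = sum f (P (Suc m))"
    unfolding jacobi_trudi_def assms P_def by (intro sum.cong refl) (simp only: f_def)
  also have "\<dots> = (\<Sum>b\<in>{0..<Suc m}. \<Sum>\<sigma> | \<sigma> \<in> P (Suc m) \<and> \<sigma> 0 = b. f \<sigma>)"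
    by (rule sum.group[symmetric]) (use fin in \<open>auto simp: P_def permutes_in_image\<close>)
  also have "\<dots> = (\<Sum>b\<in>{0..<Suc m}. (- 1) ^ b * (e (int (ls ! b) - int b) * jacobi_trudi (remove_column b ls)))"
  proof (rule sum.cong[OF refl])
    fix b assume "b \<in> {0..<Suc m}"
    then have b: "b < Suc m" by simp
    define I :: "(nat \<Rightarrow> nat) \<Rightarrow> nat \<Rightarrow> nat" where "I = permutation_insert 0 b"
    have "(\<Sum>\<sigma> | \<sigma> \<in> P (Suc m) \<and> \<sigma> 0 = b. f \<sigma>) = sum f (I ` P m)"
      using permutation_fix[of 0 m b] b by (simp add: P_def I_def)
    also have "\<dots> = (\<Sum>\<tau>\<in>P m. f (I \<tau>))"
      using permutation_insert_inj_on[of 0 m b] b by (subst sum.reindex) (simp_all add: P_def I_def)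
    also have "\<dots> = (\<Sum>\<tau>\<in>P m. (- 1) ^ b * (e (int (ls ! b) - int b) * (of_int (sign \<tau>) *
       prod_list (map (\<lambda>i. e (int (remove_column b ls ! \<tau> i) - int (\<tau> i) + int i)) [0..<m]))))"
    proof (rule sum.cong[OF refl])
      fix \<tau> assume "\<tau> \<in> P m"
      then have \<tau>: "\<tau> permutes {0..<m}" by (simp add: P_def)
      have sgn: "of_int (sign (I \<tau>)) = ((- 1) ^ b * of_int (sign \<tau>) :: word_poly)"
        using signof_permutation_insert[OF \<tau>, of 0 b] b by (simp add: I_def)
      have I0: "I \<tau> 0 = b" by (simp add: I_def permutation_insert_expand)
      have ISuc: "e (int (ls ! I \<tau> (Suc i)) - int (I \<tau> (Suc i)) + int (Suc i)) =
          e (int (remove_column b ls ! \<tau> i) - int (\<tau> i) + int i)" if "i < m" for i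
      proof -
        have "\<tau> i < m" using permutes_in_image[OF \<tau>, of i] that by simp
        with b assms show ?thesis
          by (auto simp: I_def permutation_insert_expand nth_remove_column algebra_simps)
      qed
      have "prod_list (map (\<lambda>i. e (int (ls ! I \<tau> i) - int (I \<tau> i) + int i)) [0..<Suc m]) =
          e (int (ls ! b) - int b) *
          prod_list (map (\<lambda>i. e (int (ls ! I \<tau> (Suc i)) - int (I \<tau> (Suc i)) + int (Suc i))) [0..<m])"
        unfolding upt_conv_Cons[OF zero_less_Suc] map_Suc_upt[symmetric] by (simp add: I0 o_def)
      also have "map (\<lambda>i. e (int (ls ! I \<tau> (Suc i)) - int (I \<tau> (Suc i)) + int (Suc i))) [0..<m] =
          map (\<lambda>i. e (int (remove_column b ls ! \<tau> i) - int (\<tau> i) + int i)) [0..<m]"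
        using ISuc by simp
      finally have prod: "prod_list (map (\<lambda>i. e (int (ls ! I \<tau> i) - int (I \<tau> i) + int i)) [0..<Suc m]) =
          e (int (ls ! b) - int b) *
          prod_list (map (\<lambda>i. e (int (remove_column b ls ! \<tau> i) - int (\<tau> i) + int i)) [0..<m])" .
      show "f (I \<tau>) = (- 1) ^ b * (e (int (ls ! b) - int b) * (of_int (sign \<tau>) *
          prod_list (map (\<lambda>i. e (int (remove_column b ls ! \<tau> i) - int (\<tau> i) + int i)) [0..<m])))"
        unfolding f_def sgn prod by (cases "evenperm \<tau>") (simp_all add: sign_def mult.assoc)
    qed
    also have "\<dots> = (- 1) ^ b * (e (int (ls ! b) - int b) * jacobi_trudi (remove_column b ls))"
      using b assms by (simp add: jacobi_trudi_def P_def sum_distrib_left)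
    finally show "(\<Sum>\<sigma> | \<sigma> \<in> P (Suc m) \<and> \<sigma> 0 = b. f \<sigma>) = \<dots>" .
  qed
  finally show ?thesis by (simp add: atLeast0LessThan)
qed

lemma carrier_neg_power: "(- 1) ^ b \<in> carrier U"
  by (induction b) (auto intro: carrier_simps)

text \<open>At the ends of the telescoping sum, \<open>Y 0\<close> bounds each entry by that of
  \<open>ls\<close>, so equality of the sums leaves only \<open>ls\<close>; in \<open>X m\<close>
  each entry exceeds that of \<open>ls\<close>, so nothing is left.\<close>

lemma alternating_pieri:
  assumes "length ls = Suc m" "sorted_wrt (\<ge>) ls"
  shows "(\<Sum>b<Suc m. (- 1) ^ b * (\<Sum>ms | interlaces ms (remove_column b ls) \<and>
      sum_list ms = sum_list ls. schur ms)) = schur ls"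
proof -
  define V where "V b = {ms. interlaces ms (remove_column b ls) \<and> sum_list ms = sum_list ls}" for b
  define X where "X b = {ms \<in> V b. ls ! b < ms ! b}" for b
  define Y where "Y b = {ms \<in> V b. ms ! b \<le> ls ! b}" for b
  have V_iff: "ms \<in> V b \<longleftrightarrow> length ms = Suc m \<and> sum_list ms = sum_list ls \<and>
      (\<forall>j<m. if j < b then ms ! Suc j \<le> Suc (ls ! j) \<and> Suc (ls ! j) \<le> ms ! j
        else ms ! Suc j \<le> ls ! Suc j \<and> ls ! Suc j \<le> ms ! j)" if "b < Suc m" for b ms
    using that assms(1) by (auto simp: V_def interlaces_iff_nth nth_remove_column)
  have dec: "ls ! Suc j \<le> ls ! j" if "j < m" for j
    using sorted_wrt_nth_less[OF assms(2), of j "Suc j"] that assms(1) by simp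
  have fin: "finite (V b)" for b
    using finite_interlaces[of "remove_column b ls" "int (sum_list ls)"] by (simp add: V_def)
  have sum_V: "sum schur (V b) = sum schur (X b) + sum schur (Y b)" for b
    unfolding X_def Y_def using fin[of b] by (subst sum.union_disjoint[symmetric]) (auto intro: sum.cong)
  \<comment> \<open>\<open>V b\<close> and \<open>V (Suc b)\<close> differ only in the condition at
    \<open>j = b\<close>. Both sides amount to \<open>ls ! b < ms ! b\<close> and
    \<open>ms ! Suc b <= ls ! Suc b\<close> there; the other bounds follow because \<open>ls\<close>
    decreases.\<close>
  have shift: "Y (Suc b) = X b" if "b < m" for b
  proof -
    have "ms \<in> Y (Suc b) \<longleftrightarrow> ms \<in> X b" for ms
    proof -
      have split: "(\<forall>j<m. Q j) \<longleftrightarrow> (\<forall>j<m. j \<noteq> b \<longrightarrow> Q j) \<and> Q b" for Q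
        using that by auto
      show ?thesis
        unfolding X_def Y_def mem_Collect_eq
        using that dec[OF that]
        by (simp only: V_iff less_SucI Suc_less_eq, subst (1 2) split) (auto simp: less_Suc_eq)
    qed
    then show ?thesis by blast
  qed
  have sum_nth: "sum_list ms = (\<Sum>j<Suc m. ms ! j)" if "length ms = Suc m" for ms :: "nat list"
    using that by (simp add: sum_list_sum_nth atLeast0LessThan)
  have "Y 0 = {ls}"
  proof (intro equalityI subsetI)
    fix ms assume ms: "ms \<in> Y 0"
    then have len: "length ms = Suc m" and sum: "sum_list ms = sum_list ls"
      by (auto simp: Y_def V_iff)
    have le: "ms ! j \<le> ls ! j" if "j < Suc m" for j
      using ms that by (cases j) (auto simp: Y_def V_iff)
    have "ms ! j = ls ! j" if "j < Suc m" for j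
    proof (rule ccontr)
      assume "ms ! j \<noteq> ls ! j"
      with le[OF that] have "ms ! j < ls ! j" by simp
      then have "(\<Sum>j<Suc m. ms ! j) < (\<Sum>j<Suc m. ls ! j)"
        using le that by (intro sum_strict_mono_ex1) auto
      with sum len assms(1) show False by (simp only: sum_nth)
    qed
    with len assms(1) show "ms \<in> {ls}" by (auto intro: nth_equalityI)
  qed (use assms dec in \<open>auto simp: Y_def V_iff\<close>)
  moreover have "X m = {}"
  proof (rule ccontr)
    assume "X m \<noteq> {}"
    then obtain ms where ms: "ms \<in> X m" by auto
    then have len: "length ms = Suc m" and sum: "sum_list ms = sum_list ls"
      by (auto simp: X_def V_iff)
    have "ls ! j < ms ! j" if "j < Suc m" for j
      using ms that by (auto simp: X_def V_iff less_Suc_eq Suc_le_eq)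
    then have "(\<Sum>j<Suc m. ls ! j) < (\<Sum>j<Suc m. ms ! j)"
      by (intro sum_strict_mono) auto
    with sum len assms(1) show False by (simp only: sum_nth)
  qed
  ultimately show ?thesis
    using alternating_telescope[of m "\<lambda>b. sum schur (Y b)" "\<lambda>b. sum schur (X b)"] shift
    unfolding V_def[symmetric] sum_V by simp
qed

lemma jacobi_trudi_cong_schur: "sorted_wrt (\<ge>) ls \<Longrightarrow> jacobi_trudi ls \<approx> schur ls"
proof (induction "length ls" arbitrary: ls)
  case 0
  then show ?case
    by (simp add: jacobi_trudi_def schur_Nil sign_id cong_refl carrier_simps)
next
  case (Suc m)
  have len: "length ls = Suc m" using Suc by simp
  have "jacobi_trudi ls =
      (\<Sum>b<Suc m. (- 1) ^ b * (e (int (ls ! b) - int b) * jacobi_trudi (remove_column b ls)))"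
    by (rule jacobi_trudi_expand[OF len])
  also have "\<dots> \<approx> (\<Sum>b<Suc m. (- 1) ^ b * (\<Sum>ms | interlaces ms (remove_column b ls) \<and>
      sum_list ms = sum_list ls. schur ms))"
  proof (intro cong_sum cong_mult cong_refl carrier_neg_power)
    fix b assume "b \<in> {..<Suc m}"
    then have b: "b < length ls" using len by simp
    have "jacobi_trudi (remove_column b ls) \<approx> schur (remove_column b ls)"
      using b len Suc.prems by (intro Suc.hyps(1) sorted_remove_column) simp_all
    then have "e (int (ls ! b) - int b) * jacobi_trudi (remove_column b ls) \<approx>
        e (int (ls ! b) - int b) * schur (remove_column b ls)"
      by (rule cong_mult[OF cong_refl[OF carrier_elem_sym]])
    also have "\<dots> \<approx> (\<Sum>ms | interlaces ms (remove_column b ls) \<and>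
        int (sum_list ms) = int (ls ! b) - int b + int (sum_list (remove_column b ls)). schur ms)"
      by (rule pieri)
    also have "int (ls ! b) - int b + int (sum_list (remove_column b ls)) = int (sum_list ls)"
      using sum_list_remove_column[OF b] by linarith
    finally show "e (int (ls ! b) - int b) * jacobi_trudi (remove_column b ls) \<approx>
        (\<Sum>ms | interlaces ms (remove_column b ls) \<and> sum_list ms = sum_list ls. schur ms)"
      by simp
  qed
  also have "\<dots> = schur ls" by (rule alternating_pieri[OF len Suc.prems])
  finally show ?case .
qed

text \<open>Commutation of the \<open>e k\<close> enters here: modulo the ideal, the product no
  longer depends on the order in which a determinant lists its factors.\<close>

lemma prod_list_permute:
  assumes "mset xs = mset ys" "set xs \<subseteq> range e"
  shows "prod_list xs \<approx> prod_list ys"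
  using assms
proof (induction xs arbitrary: ys)
  case (Cons x xs)
  have carrier: "prod_list zs \<in> carrier U" if "set zs \<subseteq> range e" for zs
    using that carrier_elem_sym by (intro carrier_prod_list) auto
  have move: "x * prod_list zs \<approx> prod_list zs * x" if "set zs \<subseteq> range e" for zs
    using that
  proof (induction zs)
    case (Cons z zs)
    have x: "x \<in> range e" using Cons.prems \<open>set (x # xs) \<subseteq> range e\<close> by simp
    then have "x * z \<approx> z * x" using Cons.prems elem_sym_commute by auto
    then have "x * z * prod_list zs \<approx> z * x * prod_list zs"
      using Cons.prems by (intro cong_mult[OF _ cong_refl[OF carrier]]) auto
    also have "z * x * prod_list zs = z * (x * prod_list zs)" by (simp add: mult.assoc)
    also have "\<dots> \<approx> z * (prod_list zs * x)"
      using Cons carrier_elem_sym by (intro cong_mult cong_refl Cons.IH) auto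
    finally show ?case by (simp add: mult.assoc)
  qed (use Cons.prems carrier_elem_sym in \<open>auto intro: cong_refl\<close>)
  have "x \<in> set ys" using Cons.prems by (metis list.set_intros(1) set_mset_mset)
  then obtain us vs where ys: "ys = us @ x # vs" by (meson split_list)
  have sets: "set us \<subseteq> range e" "set vs \<subseteq> range e" "x \<in> range e"
    using Cons.prems(2) arg_cong[OF Cons.prems(1), of set_mset] by (auto simp: ys)
  have "x * prod_list xs \<approx> x * prod_list (us @ vs)"
    using Cons.prems ys sets carrier_elem_sym by (intro cong_mult cong_refl Cons.IH) auto
  also have "\<dots> = x * prod_list us * prod_list vs" by (simp add: mult.assoc)
  also have "\<dots> \<approx> prod_list us * x * prod_list vs"
    using sets by (intro cong_mult cong_refl move carrier)
  finally show ?case by (simp add: ys mult.assoc)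
qed (simp add: cong_refl carrier_simps)

end

section \<open>Tableaux as lists of columns\<close>

lemma downset_eq_atLeastAtMost:
  fixes S :: "nat set"
  assumes "finite S" "0 \<notin> S" "\<And>i j. i \<in> S \<Longrightarrow> 1 \<le> j \<Longrightarrow> j \<le> i \<Longrightarrow> j \<in> S"
  shows "S = {1..card S}"
proof (cases "S = {}")
  case False
  have "S = {1..Max S}"
  proof (intro equalityI subsetI)
    fix i assume "i \<in> S"
    then show "i \<in> {1..Max S}" using assms(1,2) by (cases i) auto
  next
    fix i assume "i \<in> {1..Max S}"
    then show "i \<in> S" using assms(3)[of "Max S" i] Max_in[OF assms(1) False] by simp
  qed
  then show ?thesis by (metis card_atLeastAtMost diff_Suc_1)
qed simp

lemma part_antimono:
  assumes "is_partition \<nu>" "1 \<le> i" "i \<le> i'"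
  shows "part \<nu> i' \<le> part \<nu> i"
  using assms sorted_wrt_nth_less[of "(\<ge>)" \<nu> "i - 1" "i' - 1"]
  by (cases "i = i'") (auto simp: part_def is_partition_def)

text \<open>Each column is a finite down-set of row numbers, hence an initial segment whose length
  is its cardinality.\<close>

lemma diagram_iff:
  assumes "is_partition \<nu>"
  shows "(i, j) \<in> diagram \<nu> \<longleftrightarrow> j \<in> {1..part \<nu> 1} \<and> i \<in> {1..conj_part \<nu> j}"
proof (cases "j \<ge> 1")
  case True
  define S where "S = {i. (i, j) \<in> diagram \<nu>}"
  have "finite S"
    unfolding S_def by (rule finite_subset[OF _ finite_imageI[OF finite_diagram, of fst]]) force
  then have "S = {1..conj_part \<nu> j}"
    unfolding conj_part_def S_def[symmetric]
    by (rule downset_eq_atLeastAtMost)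
      (use part_antimono[OF assms] in \<open>auto simp: S_def diagram_def intro: order_trans\<close>)
  then have "(i, j) \<in> diagram \<nu> \<longleftrightarrow> i \<in> {1..conj_part \<nu> j}"
    unfolding S_def by blast
  moreover have "j \<le> part \<nu> 1" if "(i, j) \<in> diagram \<nu>"
    using that part_antimono[OF assms, of 1 i] by (auto simp: diagram_def)
  ultimately show ?thesis using True by auto
qed (auto simp: diagram_def)

lemma conj_part_antimono:
  assumes "1 \<le> j" "j \<le> j'"
  shows "conj_part \<nu> j' \<le> conj_part \<nu> j"
  unfolding conj_part_def
proof (rule card_mono)
  show "finite {i. (i, j) \<in> diagram \<nu>}"
    by (rule finite_subset[OF _ finite_imageI[OF finite_diagram, of fst]]) force
qed (use assms in \<open>auto simp: diagram_def\<close>)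

definition column_lengths :: "nat list \<Rightarrow> nat list" where
  "column_lengths \<nu> = map (conj_part \<nu>) [1..<Suc (part \<nu> 1)]"

lemma length_column_lengths [simp]: "length (column_lengths \<nu>) = part \<nu> 1"
  by (simp add: column_lengths_def)

lemma nth_column_lengths: "j < part \<nu> 1 \<Longrightarrow> column_lengths \<nu> ! j = conj_part \<nu> (Suc j)"
  by (simp add: column_lengths_def del: upt_Suc)

lemma sorted_column_lengths: "sorted_wrt (\<ge>) (column_lengths \<nu>)"
  by (auto simp: sorted_wrt_iff_nth_less nth_column_lengths intro: conj_part_antimono)

definition columns_of :: "nat list \<Rightarrow> (nat \<times> nat \<Rightarrow> letter) \<Rightarrow> letter list list" where
  "columns_of \<nu> T = map (\<lambda>j. map (\<lambda>i. T (i, j)) [1..<Suc (conj_part \<nu> j)]) [1..<Suc (part \<nu> 1)]"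

lemma creading_columns_of: "creading \<nu> T = concat (map rev (columns_of \<nu> T))"
  by (simp add: creading_def columns_of_def rev_map o_def del: upt_Suc)

lemma map_length_columns_of: "map length (columns_of \<nu> T) = column_lengths \<nu>"
  by (simp add: columns_of_def column_lengths_def o_def del: upt_Suc)

lemma length_columns_of [simp]: "length (columns_of \<nu> T) = part \<nu> 1"
  by (simp add: columns_of_def)

lemma length_nth_columns_of [simp]:
  "j < part \<nu> 1 \<Longrightarrow> length (columns_of \<nu> T ! j) = conj_part \<nu> (Suc j)"
  by (simp add: columns_of_def del: upt_Suc)

lemma nth_columns_of:
  "j < part \<nu> 1 \<Longrightarrow> i < conj_part \<nu> (Suc j) \<Longrightarrow> columns_of \<nu> T ! j ! i = T (Suc i, Suc j)"
  by (simp add: columns_of_def del: upt_Suc)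

section \<open>Comparison with \<open>nc_schur\<close> and \<open>colored_tableaux\<close>\<close>

context shuffle
begin

text \<open>Counting from 0 instead of 1 keeps every index of \<open>e\<close>, because two shifts
  cancel. Passing to inverse permutations transposes the matrix; only the reordering of factors that
  this entails needs the ideal.\<close>

lemma nc_schur_cong_jacobi_trudi: "nc_schur N lt \<nu> \<approx> jacobi_trudi (column_lengths \<nu>)"
proof -
  define t where "t = part \<nu> 1"
  define ls where "ls = column_lengths \<nu>"
  have bij: "bij_betw Suc {0..<t} {1..t}"
    by (rule bij_betw_byWitness[of _ "\<lambda>i. i - 1"]) auto
  define f where "f p = of_int (sign p) * prod_list (map (\<lambda>j. e (int (ls ! j) + int (p j) - int j)) [0..<t])" for p
  define g where "g \<pi> = of_int (sign \<pi>) *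
    prod_list (map (\<lambda>j. e (int (conj_part \<nu> j) + int (\<pi> j) - int j)) [1..<Suc t])" for \<pi>
  have "nc_schur N lt \<nu> = (\<Sum>\<pi> | \<pi> permutes {1..t}. g \<pi>)"
    by (simp add: nc_schur_def Let_def t_def g_def del: upt_Suc)
  also have "\<dots> = (\<Sum>p | p permutes {0..<t}. f p)"
  proof (rule sum.reindex_bij_witness[of _ "map_permutation {0..<t} Suc" "map_permutation {1..t} (\<lambda>i. i - 1)"])
    have bij': "bij_betw (\<lambda>i. i - 1) {1..t} {0..<t}"
      by (rule bij_betw_byWitness[of _ Suc]) auto
    fix \<pi> assume "\<pi> \<in> {\<pi>. \<pi> permutes {1..t}}"
    then have \<pi>: "\<pi> permutes {1..t}" by simp
    show "map_permutation {0..<t} Suc (map_permutation {1..t} (\<lambda>i. i - 1) \<pi>) = \<pi>"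
      by (rule map_permutation_compose_inv[OF bij' \<pi>]) simp
    show "map_permutation {1..t} (\<lambda>i. i - 1) \<pi> \<in> {p. p permutes {0..<t}}"
      using map_permutation_permutes[OF bij' \<pi>] by simp
    have sgn: "sign (map_permutation {1..t} (\<lambda>i. i - 1) \<pi>) = sign \<pi>"
      using bij' \<pi> by (intro sign_map_permutation) (auto simp: bij_betw_def)
    have app: "map_permutation {1..t} (\<lambda>i. i - 1) \<pi> j = \<pi> (Suc j) - 1" if "j < t" for j
      using map_permutation_apply[of "\<lambda>i. i - 1" "{1..t}" "Suc j" \<pi>] bij' that by (auto simp: bij_betw_def)
    have pos: "\<pi> (Suc j) \<ge> 1" if "j < t" for j
      using permutes_in_image[OF \<pi>, of "Suc j"] that by simp
    have ls: "ls ! j = conj_part \<nu> (Suc j)" if "j < t" for j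
      using that by (simp add: ls_def t_def nth_column_lengths)
    have arg: "int (conj_part \<nu> (Suc j)) + int (\<pi> (Suc j)) - int (Suc j) =
        int (ls ! j) + int (map_permutation {1..t} (\<lambda>i. i - 1) \<pi> j) - int j" if "j < t" for j
      unfolding app[OF that] ls[OF that] using pos[OF that] by simp
    have "map (\<lambda>j. e (int (conj_part \<nu> j) + int (\<pi> j) - int j)) [1..<Suc t] =
        map (\<lambda>j. e (int (conj_part \<nu> (Suc j)) + int (\<pi> (Suc j)) - int (Suc j))) [0..<t]"
      unfolding One_nat_def map_Suc_upt[symmetric] by (simp add: o_def)
    also have "\<dots> = map (\<lambda>j. e (int (ls ! j) + int (map_permutation {1..t} (\<lambda>i. i - 1) \<pi> j) - int j)) [0..<t]"
      by (intro map_cong refl arg_cong[where f = e] arg) simp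
    finally have "map (\<lambda>j. e (int (conj_part \<nu> j) + int (\<pi> j) - int j)) [1..<Suc t] =
        map (\<lambda>j. e (int (ls ! j) + int (map_permutation {1..t} (\<lambda>i. i - 1) \<pi> j) - int j)) [0..<t]" .
    then show "f (map_permutation {1..t} (\<lambda>i. i - 1) \<pi>) = g \<pi>"
      by (simp only: f_def g_def sgn)
  next
    fix p assume "p \<in> {p. p permutes {0..<t}}"
    then have p: "p permutes {0..<t}" by simp
    show "map_permutation {1..t} (\<lambda>i. i - 1) (map_permutation {0..<t} Suc p) = p"
      by (rule map_permutation_compose_inv[OF bij p]) simp
    show "map_permutation {0..<t} Suc p \<in> {\<pi>. \<pi> permutes {1..t}}"
      using map_permutation_permutes[OF bij p] by simp
  qed
  also have "\<dots> = (\<Sum>p | p permutes {0..<t}. f (inv_into UNIV p))"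
    by (rule sum_permutations_inverse)
  also have "\<dots> \<approx> jacobi_trudi ls"
  proof -
    have summand: "f (inv_into UNIV p) \<approx> of_int (sign p) *
        prod_list (map (\<lambda>i. e (int (ls ! p i) - int (p i) + int i)) [0..<t])"
      if "p permutes {0..<t}" for p
    proof -
      \<comment> \<open>For \<open>j = p i\<close> the index \<open>ls ! p i - p i + i\<close> is
        the one that the inverse permutation gives at \<open>j\<close>, so both products have the
        same multiset of factors.\<close>
      have "mset (map (\<lambda>i. e (int (ls ! p i) - int (p i) + int i)) [0..<t]) =
          image_mset (\<lambda>i. e (int (ls ! p i) + int (inv_into UNIV p (p i)) - int (p i))) (mset_set {0..<t})"
        by (simp add: permutes_inverses(2)[OF that] algebra_simps)
      also have "\<dots> = image_mset (\<lambda>j. e (int (ls ! j) + int (inv_into UNIV p j) - int j)) (image_mset p (mset_set {0..<t}))"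
        by (simp add: multiset.map_comp o_def)
      also have "image_mset p (mset_set {0..<t}) = mset_set {0..<t}"
        using permutes_image[OF that] permutes_inj_on[OF that]
        by (subst image_mset_mset_set) auto
      finally have perm: "prod_list (map (\<lambda>j. e (int (ls ! j) + int (inv_into UNIV p j) - int j)) [0..<t]) \<approx>
          prod_list (map (\<lambda>i. e (int (ls ! p i) - int (p i) + int i)) [0..<t])"
        by (intro prod_list_permute) auto
      have "sign (inv_into UNIV p) = sign p"
        by (rule sign_inverse[OF permutes_imp_permutation[OF _ that]]) simp
      moreover have "of_int (sign p) \<in> carrier U"
        by (cases "evenperm p") (simp_all add: sign_def carrier_simps)
      ultimately show ?thesis
        using cong_mult[OF cong_refl perm] by (simp add: f_def)
    qed
    have len: "length ls = t" by (simp add: ls_def t_def)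
    show ?thesis unfolding jacobi_trudi_def len by (rule cong_sum) (use summand in blast)
  qed
  finally show ?thesis by (simp add: ls_def)
qed

lemma sum_creading:
  assumes "is_partition \<nu>"
  shows "(\<Sum>T\<in>colored_tableaux N lt \<nu>. word_mon (creading \<nu> T)) = schur (column_lengths \<nu>)"
proof -
  define t where "t = part \<nu> 1"
  define c where "c j = conj_part \<nu> j" for j
  have diagram: "(i, j) \<in> diagram \<nu> \<longleftrightarrow> 1 \<le> j \<and> j \<le> t \<and> 1 \<le> i \<and> i \<le> c j" for i j
    using diagram_iff[OF assms] by (auto simp: t_def c_def)
  have row_iff: "row x y \<longleftrightarrow> lt x y \<or> x = y \<and> \<not> barred x" if "x \<in> alph" "y \<in> alph" for x y
    using that lt_order(1)[of x] lt_order(2)[of x y x] lt_order(3)[of x y] by (auto simp: col_def col_ge_def)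
  have col_iff: "col y x \<longleftrightarrow> lt x y \<or> x = y \<and> barred x" if "x \<in> alph" "y \<in> alph" for x y
    using that by (auto simp: col_def col_ge_def)
  \<comment> \<open>The tableau conditions restated with \<open>row\<close> and \<open>col\<close>,
    which is legitimate because all entries lie in the alphabet.\<close>
  define tabs where "tabs = {T \<in> diagram \<nu> \<rightarrow>\<^sub>E alph.
     (\<forall>i j j'. (i, j) \<in> diagram \<nu> \<and> (i, j') \<in> diagram \<nu> \<and> j < j' \<longrightarrow> row (T (i, j)) (T (i, j'))) \<and>
     (\<forall>i i' j. (i, j) \<in> diagram \<nu> \<and> (i', j) \<in> diagram \<nu> \<and> i < i' \<longrightarrow> col (T (i', j)) (T (i, j)))}"
  have "T \<in> colored_tableaux N lt \<nu> \<longleftrightarrow> T \<in> tabs" for T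
  proof (cases "T \<in> diagram \<nu> \<rightarrow>\<^sub>E alph")
    case True
    then have mem: "p \<in> diagram \<nu> \<Longrightarrow> T p \<in> alph" for p by (rule PiE_mem)
    have "(\<forall>i j j'. (i, j) \<in> diagram \<nu> \<and> (i, j') \<in> diagram \<nu> \<and> j < j' \<longrightarrow> row (T (i, j)) (T (i, j'))) \<longleftrightarrow>
        (\<forall>i j j'. (i, j) \<in> diagram \<nu> \<and> (i, j') \<in> diagram \<nu> \<and> j < j' \<longrightarrow>
          lt (T (i, j)) (T (i, j')) \<or> T (i, j) = T (i, j') \<and> \<not> barred (T (i, j)))"
      by (intro all_cong1 imp_cong refl, rule row_iff) (simp_all add: mem)
    moreover have "(\<forall>i i' j. (i, j) \<in> diagram \<nu> \<and> (i', j) \<in> diagram \<nu> \<and> i < i' \<longrightarrow> col (T (i', j)) (T (i, j))) \<longleftrightarrow>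
        (\<forall>i i' j. (i, j) \<in> diagram \<nu> \<and> (i', j) \<in> diagram \<nu> \<and> i < i' \<longrightarrow>
          lt (T (i, j)) (T (i', j)) \<or> T (i, j) = T (i', j) \<and> barred (T (i, j)))"
      by (intro all_cong1 imp_cong refl, rule col_iff) (simp_all add: mem)
    ultimately show ?thesis using True by (simp only: colored_tableaux_def tabs_def mem_Collect_eq)
  qed (simp add: colored_tableaux_def tabs_def)
  then have "colored_tableaux N lt \<nu> = tabs" by blast
  have "bij_betw (columns_of \<nu>) tabs (tableaux (column_lengths \<nu>))"
  proof (rule bij_betw_imageI)
    show "inj_on (columns_of \<nu>) tabs"
    proof (rule inj_onI)
      fix T T' assume T: "T \<in> tabs" "T' \<in> tabs" and eq: "columns_of \<nu> T = columns_of \<nu> T'"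
      show "T = T'"
      proof (rule PiE_ext)
        show "T \<in> diagram \<nu> \<rightarrow>\<^sub>E alph" "T' \<in> diagram \<nu> \<rightarrow>\<^sub>E alph"
          using T by (auto simp: tabs_def)
        fix ij assume "ij \<in> diagram \<nu>"
        then obtain i j where ij: "ij = (Suc i, Suc j)" "j < t" "i < c (Suc j)"
          using diagram by (cases ij; cases "fst ij"; cases "snd ij") auto
        then show "T ij = T' ij"
          using nth_columns_of[of j \<nu> i T] nth_columns_of[of j \<nu> i T'] eq by (simp add: t_def c_def)
      qed
    qed
    show "columns_of \<nu> ` tabs = tableaux (column_lengths \<nu>)"
    proof (intro equalityI subsetI)
      fix cs assume "cs \<in> columns_of \<nu> ` tabs"
      then obtain T where T: "T \<in> tabs" and cs: "cs = columns_of \<nu> T" by auto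
      have "T (i, j) \<in> alph" if "(i, j) \<in> diagram \<nu>" for i j
        using T that by (auto simp: tabs_def)
      then have "set (concat cs) \<subseteq> alph"
        by (auto simp: cs columns_of_def diagram t_def c_def simp del: upt_Suc)
      moreover have "column x" if "x \<in> set cs" for x
      proof -
        from that obtain j where j: "j < t" "x = columns_of \<nu> T ! j"
          by (auto simp: cs in_set_conv_nth t_def)
        then show ?thesis
          using T by (auto simp: column_def sorted_wrt_iff_nth_less nth_columns_of tabs_def diagram t_def c_def)
      qed
      moreover have "successively tab cs"
        unfolding successively_conv_nth
      proof (intro allI impI)
        fix j assume "Suc j < length cs"
        then have j: "Suc j < t" by (simp add: cs t_def)
        have "conj_part \<nu> (Suc (Suc j)) \<le> conj_part \<nu> (Suc j)"
          by (rule conj_part_antimono) simp_all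
        then show "tab (cs ! j) (cs ! Suc j)"
          using T j unfolding tab_def cs
          by (auto simp: nth_columns_of tabs_def diagram t_def c_def)
      qed
      ultimately show "cs \<in> tableaux (column_lengths \<nu>)"
        by (auto simp: tableaux_def tableau_def map_length_columns_of cs)
    next
      fix cs assume cs: "cs \<in> tableaux (column_lengths \<nu>)"
      then have lens: "map length cs = column_lengths \<nu>" and colcs: "\<And>x. x \<in> set cs \<Longrightarrow> column x"
        and succ: "successively tab cs" and sub: "set (concat cs) \<subseteq> alph"
        by (auto simp: tableaux_def tableau_def)
      have len: "length cs = t" using arg_cong[OF lens, of length] by (simp add: t_def)
      have lenj: "length (cs ! j) = c (Suc j)" if "j < t" for j
        using arg_cong[OF lens, of "\<lambda>xs. xs ! j"] that len by (simp add: nth_column_lengths t_def c_def)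
      define T where "T = restrict (\<lambda>(i, j). cs ! (j - 1) ! (i - 1)) (diagram \<nu>)"
      have T: "T (Suc i, Suc j) = cs ! j ! i" if "j < t" "i < c (Suc j)" for i j
        using that by (simp add: T_def diagram)
      have "T (i, j) \<in> alph" if "(i, j) \<in> diagram \<nu>" for i j
      proof -
        from that have "j - 1 < t" "i - 1 < c (Suc (j - 1))" by (auto simp: diagram)
        then have "cs ! (j - 1) ! (i - 1) \<in> set (concat cs)"
          using len lenj by (auto simp: set_concat) (metis nth_mem)
        with sub that show ?thesis by (auto simp: T_def)
      qed
      moreover have "col (T (i', j)) (T (i, j))"
        if "(i, j) \<in> diagram \<nu>" "(i', j) \<in> diagram \<nu>" "i < i'" for i i' j
      proof -
        from that have "j - 1 < t" "i - 1 < i' - 1" "i' - 1 < c (Suc (j - 1))" by (auto simp: diagram)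
        then show ?thesis
          using column_nth[OF colcs[of "cs ! (j - 1)"], of "i - 1" "i' - 1"] that len lenj
          by (simp add: T_def)
      qed
      moreover have "row (T (i, j)) (T (i, j'))"
        if "(i, j) \<in> diagram \<nu>" "(i, j') \<in> diagram \<nu>" "j < j'" for i j j'
      proof -
        \<comment> \<open>\<open>tab\<close> only relates adjacent columns. Distant cells of a row
          are linked through the cells between them, which exist since the column lengths decrease,
          by transitivity of \<open>row\<close>.\<close>
        have step: "row (cs ! k ! (i - 1)) (cs ! Suc k ! (i - 1))"
          if "Suc k < t" "i - 1 < c (Suc (Suc k))" for k
          using succ that len lenj by (auto simp: successively_conv_nth tab_def)
        have chain: "row (cs ! k ! (i - 1)) (cs ! k' ! (i - 1))"
          if "k < k'" "k' < t" "i - 1 < c (Suc k')" for k k'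
          using that
        proof (induction k')
          case (Suc k')
          have "c (Suc (Suc k')) \<le> c (Suc k')"
            unfolding c_def by (rule conj_part_antimono) simp_all
          with Suc step[of k'] show ?case
            using not_col_trans[of "cs ! k ! (i - 1)" "cs ! k' ! (i - 1)" "cs ! Suc k' ! (i - 1)"]
            by (cases "k = k'") auto
        qed simp
        from that have "j - 1 < j' - 1" "j' - 1 < t" "i - 1 < c (Suc (j' - 1))"
          by (auto simp: diagram)
        from chain[OF this] that show ?thesis by (simp add: T_def)
      qed
      ultimately have "T \<in> tabs"
        by (auto simp: tabs_def T_def)
      moreover have "columns_of \<nu> T = cs"
      proof (rule nth_equalityI)
        fix j assume "j < length (columns_of \<nu> T)"
        then have "j < t" by (simp add: t_def)
        then show "columns_of \<nu> T ! j = cs ! j"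
          using lenj T by (intro nth_equalityI) (auto simp: nth_columns_of t_def c_def)
      qed (simp add: len t_def)
      ultimately show "cs \<in> columns_of \<nu> ` tabs" by blast
    qed
  qed
  from sum.reindex_bij_betw[OF this, of "\<lambda>cs. word_mon (concat (map rev cs))"]
  show ?thesis
    unfolding \<open>colored_tableaux N lt \<nu> = tabs\<close> by (simp add: schur_def creading_columns_of)
qed

end

theorem theorem3p10:
  fixes N :: nat and lt :: "letter \<Rightarrow> letter \<Rightarrow> bool" and \<nu> :: "nat list"
  assumes "shuffle_order N lt" and "is_partition \<nu>"
  shows "plac_ideal N lt +>\<^bsub>free_alg N\<^esub> nc_schur N lt \<nu> =
         plac_ideal N lt +>\<^bsub>free_alg N\<^esub> (\<Sum>T\<in>colored_tableaux N lt \<nu>. word_mon (creading \<nu> T))"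
proof -
  interpret shuffle N lt by standard (rule assms(1))
  have "nc_schur N lt \<nu> \<approx> (\<Sum>T\<in>colored_tableaux N lt \<nu>. word_mon (creading \<nu> T))"
    unfolding sum_creading[OF assms(2)]
    using nc_schur_cong_jacobi_trudi jacobi_trudi_cong_schur[OF sorted_column_lengths]
    by (rule cong_trans)
  then show ?thesis
    using cong_carrier cong_iff_cosets by blast
qed

end
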